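(* Let $N\geq 1$ and let $\underline{\rho}=(\rho_1,\dots,\rho_N)$ be an ordered collection of irreducible Young diagram representations of $\mathfrak{gl}_2=\mathfrak{gl}_2(\mathbb{C})$. Then the $\mathfrak{gl}_2$-weight system $W_{\underline{\rho}}:\mathscr{A}^{\rm h}_N\to\mathbb{C}$ is a quantum state, i.e. $W_{\underline{\rho}}(x\cdot x^\star)$ is a real number $\geq 0$ for every $x\in\mathscr{A}^{\rm h}_N$, and $W_{\underline{\rho}}(1)>0$.
   Context: **$\star$-algebras and states.** A complex $\star$-algebra is a unital associative $\mathbb{C}$-algebra $\mathscr{O}$ with an involution $\star:\mathscr{O}\to\mathscr{O}$ such that $1^\star=1$, $(za+wb)^\star=\overline{z}a^\star+\overline{w}b^\star$ for $z,w\in\mathbb{C}$, and $(ab)^\star=b^\star a^\star$. A quantum state (or state) on $\mathscr{O}$ is a $\mathbb{C}$-linear map $\varphi:\mathscr{O}\to\mathbb{C}$ with $\varphi(x x^\star)\geq 0$ for all $x\in\mathscr{O}$ and $\varphi(1_{\mathscr{O}})>0$. **Horizontal chord diagrams.** Let $\mathscr{D}^{\rm h}_N$ be the free monoid (operation $\circ$) generated by the chords $(i,j)$, $1\leq i<j\leq N$; its neutral element is the chord-less diagram $\uparrow_N$. Write also $(j,i)=(i,j)$. The algebra of horizontal chord diagrams on $N$ strands is $\mathscr{A}^{\rm h}_N=\mathbb{C}[\mathscr{D}^{\rm h}_N]/I$, where $I$ is the two-sided ideal generated by the infinitesimal pure braid relations: $(i,j)\circ(k,l)-(k,l)\circ(i,j)$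 for pairwise distinct $i,j,k,l$ (2T), and $(i,j)\circ(i,k)+(i,j)\circ(j,k)-(i,k)\circ(i,j)-(j,k)\circ(i,j)$ for pairwise distinct $i,j,k$ (4T). It is a complex $\star$-algebra with unit $\uparrow_N$ and with $\star$ the anti-linear extension of $[(i_1,j_1)\circ\cdots\circ(i_r,j_r)]^\star=(i_r,j_r)\circ\cdots\circ(i_1,j_1)$. **Young diagram representations of $\mathfrak{gl}_2$.** Let $\lambda=(\lambda_1,\lambda_2)$ be a partition (non-empty, length at most $2$, $\lambda_1\geq\lambda_2\geq 0$, where $\lambda_2=0$ if the length is $1$). Let $\rho_\lambda^{\mathfrak{sl}}$ be the corresponding irreducible representation of $\mathfrak{sl}_2$, i.e. the one of highest weight $\lambda_1-\lambda_2$ (it is realised on the Weyl module $\mathbb{S}_\lambda(\mathbb{C}^2)$, the image of the Young symmetriser of $\lambda$ on $(\mathbb{C}^2)^{\otimes|\lambda|}$). Extend it to a representation $\rho_\lambda$ of $\mathfrak{gl}_2=\mathfrak{sl}_2\oplus\mathbb{C}\,\mathrm{Id}$ by letting the identity matrix $\mathrm{Id}$ act as $0$. For $z\in\mathbb{C}$ let $\rho_z:\mathfrak{gl}_2\to\mathrm{End}(\mathbb{C})$ be the one-dimensional representation $\rho_z(g+k\,\mathrm{Id})[x]=zkx$ for $g\in\mathfrak{sl}_2$, $k,x\in\mathbb{C}$. Every irreducible finite-dimensional representation of $\mathfrak{gl}_2$ is isomorphic to some $\rho_\lambda\otimes\rho_z$; the irreducible Young diagram representations are those with $z=1$, i.e.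 $\rho_\lambda\otimes\rho_1$. **$\mathfrak{gl}_2$-weight systems.** Equip $\mathfrak{gl}_2$ with the bilinear form $\langle A,B\rangle=\mathrm{Tr}(AB)$ and let $e_1,\dots,e_4$ be an orthonormal basis of $\mathfrak{gl}_2$ for it. Given finite-dimensional representations $\rho_i:\mathfrak{gl}_2\to\mathrm{End}(V_i)$, $i=1,\dots,N$, let $\widetilde{W}_{\underline{\rho}}:\mathscr{A}^{\rm h}_N\to\mathrm{End}(V_1\otimes\cdots\otimes V_N)$ be the unital algebra homomorphism determined by $$\widetilde{W}_{\underline{\rho}}((i,j))=\sum_{r=1}^{4}\mathrm{Id}_{V_1}\otimes\cdots\otimes\rho_i(e_r)\otimes\cdots\otimes\rho_j(e_r)\otimes\cdots\otimes\mathrm{Id}_{V_N},$$ with $\rho_i(e_r)$ in the $i$-th position, $\rho_j(e_r)$ in the $j$-th position, and identities elsewhere (it is a standard fact that this is well defined and independent of the orthonormal basis). The weight system is $W_{\underline{\rho}}(x)=\mathrm{Tr}(\widetilde{W}_{\underline{\rho}}(x))$. *)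

theory Defs
  imports
    "HOL-Library.Poly_Mapping"
    "HOL-Algebra.QuotRing"
    "Jordan_Normal_Form.VS_Connect"
begin

section \<open>Complex star-algebras and states\<close>

record 'a star_algebra = "(complex, 'a) module" +
  star :: "'a \<Rightarrow> 'a"  (\<open>\<star>\<index> _\<close> [81] 80)

locale complex_star_algebra = ring A + scal: Module.module "class_ring :: complex ring" A
  for A :: "('a, 'm) star_algebra_scheme" (structure) +
  assumes smult_mult_left: "\<lbrakk>x \<in> carrier A; y \<in> carrier A\<rbrakk> \<Longrightarrow> (c \<odot> x) \<otimes> y = c \<odot> (x \<otimes> y)"
    and smult_mult_right: "\<lbrakk>x \<in> carrier A; y \<in> carrier A\<rbrakk> \<Longrightarrow> x \<otimes> (c \<odot> y) = c \<odot> (x \<otimes> y)"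
    and star_closed: "x \<in> carrier A \<Longrightarrow> \<star> x \<in> carrier A"
    and star_star: "x \<in> carrier A \<Longrightarrow> \<star> (\<star> x) = x"
    and star_one: "\<star> \<one> = \<one>"
    and star_antilinear: "\<lbrakk>x \<in> carrier A; y \<in> carrier A\<rbrakk> \<Longrightarrow>
      \<star> (z \<odot> x \<oplus> w \<odot> y) = cnj z \<odot> \<star> x \<oplus> cnj w \<odot> \<star> y"
    and star_mult: "\<lbrakk>x \<in> carrier A; y \<in> carrier A\<rbrakk> \<Longrightarrow> \<star> (x \<otimes> y) = \<star> y \<otimes> \<star> x"

locale quantum_state = complex_star_algebra A
  for A :: "('a, 'm) star_algebra_scheme" (structure) and \<phi> :: "'a \<Rightarrow> complex" +
  assumes state_add: "\<lbrakk>x \<in> carrier A; y \<in> carrier A\<rbrakk> \<Longrightarrow> \<phi> (x \<oplus> y) = \<phi> x + \<phi> y"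
    and state_smult: "x \<in> carrier A \<Longrightarrow> \<phi> (c \<odot> x) = c * \<phi> x"
    and state_nonneg: "x \<in> carrier A \<Longrightarrow> \<phi> (x \<otimes> \<star> x) \<in> \<real> \<and> Re (\<phi> (x \<otimes> \<star> x)) \<ge> 0"
    and state_one: "\<phi> \<one> \<in> \<real> \<and> Re (\<phi> \<one>) > 0"


section \<open>Horizontal chord diagrams\<close>

text \<open>The free monoid on chords is written additively, because the convolution product of
  \<^theory>\<open>HOL-Library.Poly_Mapping\<close> makes \<open>'k \<Rightarrow>\<^sub>0 complex\<close> the monoid algebra of an
  additively written (not necessarily commutative) monoid \<open>'k\<close>.\<close>

datatype diagram = Diagram (chords: "(nat \<times> nat) list")

instantiation diagram :: monoid_add
begin

definition zero_diagram :: diagram where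
  "0 = Diagram []"

definition plus_diagram :: "diagram \<Rightarrow> diagram \<Rightarrow> diagram" where
  "v + w = Diagram (chords v @ chords w)"

instance
  by standard (simp_all add: zero_diagram_def plus_diagram_def)

end

definition diagrams :: "nat \<Rightarrow> diagram set" where
  "diagrams N = {w. set (chords w) \<subseteq> {(i, j). 1 \<le> i \<and> i < j \<and> j \<le> N}}"

definition free_algebra :: "nat \<Rightarrow> (diagram \<Rightarrow>\<^sub>0 complex) ring" where
  "free_algebra N =
    \<lparr>carrier = {x. Poly_Mapping.keys x \<subseteq> diagrams N}, mult = (*), one = 1, zero = 0, add = (+)\<rparr>"

text \<open>Taking the minimum and maximum implements the convention \<open>(j, i) = (i, j)\<close>.\<close>

definition chord :: "nat \<Rightarrow> nat \<Rightarrow> diagram \<Rightarrow>\<^sub>0 complex" where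
  "chord i j = Poly_Mapping.single (Diagram [(min i j, max i j)]) 1"

definition braid_relations :: "nat \<Rightarrow> (diagram \<Rightarrow>\<^sub>0 complex) set" where
  "braid_relations N =
    {chord i j * chord k l - chord k l * chord i j | i j k l.
       {i, j, k, l} \<subseteq> {1..N} \<and> distinct [i, j, k, l]} \<union>
    {chord i j * chord i k + chord i j * chord j k - chord i k * chord i j - chord j k * chord i j
       | i j k. {i, j, k} \<subseteq> {1..N} \<and> distinct [i, j, k]}"

definition braid_ideal :: "nat \<Rightarrow> (diagram \<Rightarrow>\<^sub>0 complex) set" where
  "braid_ideal N = Idl\<^bsub>free_algebra N\<^esub> (braid_relations N)"

definition free_star :: "(diagram \<Rightarrow>\<^sub>0 complex) \<Rightarrow> (diagram \<Rightarrow>\<^sub>0 complex)" where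
  "free_star x = (\<Sum>w \<in> Poly_Mapping.keys x.
     Poly_Mapping.single (Diagram (rev (chords w))) (cnj (Poly_Mapping.lookup x w)))"

text \<open>Elements of the quotient are cosets; a map \<open>f\<close> of the free algebra that respects the
  ideal acts on a coset \<open>X\<close> by \<open>\<Union>x\<in>X. I + f x\<close>, just as in \<^const>\<open>rcoset_mult\<close>.\<close>

definition chord_algebra :: "nat \<Rightarrow> (diagram \<Rightarrow>\<^sub>0 complex) set star_algebra" where
  "chord_algebra N = (let F = free_algebra N; I = braid_ideal N; Q = F Quot I in
    \<lparr>carrier = carrier Q, mult = mult Q, one = one Q, zero = zero Q, add = add Q,
     smult = (\<lambda>c X. \<Union>x\<in>X. I +>\<^bsub>F\<^esub> (Poly_Mapping.map ((*) c) x)),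
     star = (\<lambda>X. \<Union>x\<in>X. I +>\<^bsub>F\<^esub> (free_star x))\<rparr>)"


section \<open>Matrices\<close>

definition mat_trace :: "complex mat \<Rightarrow> complex" where
  "mat_trace A = (\<Sum>i<dim_row A. A $$ (i, i))"

definition kron :: "complex mat \<Rightarrow> complex mat \<Rightarrow> complex mat" (infixr \<open>\<otimes>\<^sub>k\<close> 70) where
  "A \<otimes>\<^sub>k B = mat (dim_row A * dim_row B) (dim_col A * dim_col B)
     (\<lambda>(i, j). A $$ (i div dim_row B, j div dim_col B) * B $$ (i mod dim_row B, j mod dim_col B))"

definition kron_list :: "complex mat list \<Rightarrow> complex mat" where
  "kron_list As = foldr (\<otimes>\<^sub>k) As (1\<^sub>m 1)"


section \<open>Young diagram representations of \<open>gl\<^sub>2\<close>\<close>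

definition gl2 :: "complex mat set" where
  "gl2 = carrier_mat 2 2"

definition sl2 :: "complex mat set" where
  "sl2 = {A \<in> gl2. mat_trace A = 0}"

text \<open>A representation of a Lie algebra \<open>\<gg>\<close> of matrices on the space \<open>\<complex>\<^sup>d\<close>; only the values
  on \<open>\<gg>\<close> are relevant.\<close>

definition lie_rep :: "complex mat set \<Rightarrow> nat \<Rightarrow> (complex mat \<Rightarrow> complex mat) \<Rightarrow> bool" where
  "lie_rep \<gg> d \<rho> \<longleftrightarrow>
    (\<forall>A\<in>\<gg>. \<rho> A \<in> carrier_mat d d) \<and>
    (\<forall>A\<in>\<gg>. \<forall>B\<in>\<gg>. \<rho> (A + B) = \<rho> A + \<rho> B) \<and>
    (\<forall>c. \<forall>A\<in>\<gg>. \<rho> (c \<cdot>\<^sub>m A) = c \<cdot>\<^sub>m \<rho> A) \<and>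
    (\<forall>A\<in>\<gg>. \<forall>B\<in>\<gg>. \<rho> (A * B - B * A) = \<rho> A * \<rho> B - \<rho> B * \<rho> A)"

definition irreducible_lie_rep :: "complex mat set \<Rightarrow> nat \<Rightarrow> (complex mat \<Rightarrow> complex mat) \<Rightarrow> bool" where
  "irreducible_lie_rep \<gg> d \<rho> \<longleftrightarrow> lie_rep \<gg> d \<rho> \<and> d > 0 \<and>
    (\<forall>W. VectorSpace.subspace class_ring W (module_vec TYPE(complex) d) \<and>
         (\<forall>A\<in>\<gg>. \<forall>v\<in>W. \<rho> A *\<^sub>v v \<in> W) \<longrightarrow>
       W = {0\<^sub>v d} \<or> W = carrier_vec d)"

definition sl2_E :: "complex mat" where
  "sl2_E = mat_of_rows_list 2 [[0, 1], [0, 0]]"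

definition sl2_H :: "complex mat" where
  "sl2_H = mat_of_rows_list 2 [[1, 0], [0, -1]]"

definition sl2_irrep :: "nat \<Rightarrow> nat \<Rightarrow> (complex mat \<Rightarrow> complex mat) \<Rightarrow> bool" where
  "sl2_irrep m d \<sigma> \<longleftrightarrow> irreducible_lie_rep sl2 d \<sigma> \<and>
    (\<exists>v \<in> carrier_vec d. v \<noteq> 0\<^sub>v d \<and> \<sigma> sl2_E *\<^sub>v v = 0\<^sub>v d \<and> \<sigma> sl2_H *\<^sub>v v = of_nat m \<cdot>\<^sub>v v)"

text \<open>The decomposition \<open>A = g + k Id\<close> with \<open>g \<in> sl\<^sub>2\<close>.\<close>

definition gl2_scalar :: "complex mat \<Rightarrow> complex" where
  "gl2_scalar A = mat_trace A / 2"

definition gl2_traceless :: "complex mat \<Rightarrow> complex mat" where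
  "gl2_traceless A = A - gl2_scalar A \<cdot>\<^sub>m 1\<^sub>m 2"

definition extend_rep :: "(complex mat \<Rightarrow> complex mat) \<Rightarrow> complex mat \<Rightarrow> complex mat" where
  "extend_rep \<sigma> A = \<sigma> (gl2_traceless A)"

definition scalar_rep :: "complex \<Rightarrow> complex mat \<Rightarrow> complex mat" where
  "scalar_rep z A = (z * gl2_scalar A) \<cdot>\<^sub>m 1\<^sub>m 1"

definition tensor_rep :: "nat \<Rightarrow> (complex mat \<Rightarrow> complex mat) \<Rightarrow> nat \<Rightarrow> (complex mat \<Rightarrow> complex mat) \<Rightarrow>
    complex mat \<Rightarrow> complex mat" where
  "tensor_rep d \<rho> d' \<rho>' A = \<rho> A \<otimes>\<^sub>k 1\<^sub>m d' + 1\<^sub>m d \<otimes>\<^sub>k \<rho>' A"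

text \<open>The pair \<open>(l\<^sub>1, l\<^sub>2)\<close> is a non-empty partition of length at most two, with \<open>l\<^sub>2 = 0\<close> for
  length one. Since \<open>\<sigma>\<close> ranges over all matrix realisations of the irreducible representation of highest
  weight \<open>l\<^sub>1 - l\<^sub>2\<close>, this predicate is invariant under isomorphism of representations.\<close>

definition young_rep :: "nat \<Rightarrow> (complex mat \<Rightarrow> complex mat) \<Rightarrow> bool" where
  "young_rep d \<rho> \<longleftrightarrow> (\<exists>l\<^sub>1 l\<^sub>2 \<sigma>. l\<^sub>1 \<ge> l\<^sub>2 \<and> l\<^sub>1 > 0 \<and>
     sl2_irrep (l\<^sub>1 - l\<^sub>2) d \<sigma> \<and>
     (\<forall>A\<in>gl2. \<rho> A = tensor_rep d (extend_rep \<sigma>) 1 (scalar_rep 1) A))"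


section \<open>Weight systems\<close>

text \<open>The form \<open>Tr (A B)\<close> is bilinear, without complex conjugation.\<close>

definition orthonormal_basis_gl2 :: "(nat \<Rightarrow> complex mat) \<Rightarrow> bool" where
  "orthonormal_basis_gl2 e \<longleftrightarrow>
    vectorspace.basis class_ring (module_mat TYPE(complex) 2 2) (e ` {1..4}) \<and>
    (\<forall>r\<in>{1..4}. \<forall>s\<in>{1..4}. mat_trace (e r * e s) = (if r = s then 1 else 0))"

definition tensor_dim :: "nat \<Rightarrow> (nat \<Rightarrow> nat) \<Rightarrow> nat" where
  "tensor_dim N d = (\<Prod>k = 1..N. d k)"

text \<open>In the definitions below, strand \<open>k \<in> {1..N}\<close> carries the representation \<open>\<rho> k\<close> on \<open>\<complex>\<^bsup>d k\<^esup>\<close>,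
  and \<open>e\<close> is an orthonormal basis of \<open>gl\<^sub>2\<close>.\<close>

definition chord_operator ::
  "nat \<Rightarrow> (nat \<Rightarrow> nat) \<Rightarrow> (nat \<Rightarrow> complex mat \<Rightarrow> complex mat) \<Rightarrow> (nat \<Rightarrow> complex mat) \<Rightarrow>
   nat \<times> nat \<Rightarrow> complex mat" where
  "chord_operator N d \<rho> e = (\<lambda>(i, j).
     let D = tensor_dim N d in
     \<Oplus>\<^bsub>module_mat TYPE(complex) D D\<^esub> r\<in>{1..4::nat}.
       kron_list (map (\<lambda>k. if k = i \<or> k = j then \<rho> k (e r) else 1\<^sub>m (d k)) [1..<N+1]))"

definition diagram_operator ::
  "nat \<Rightarrow> (nat \<Rightarrow> nat) \<Rightarrow> (nat \<Rightarrow> complex mat \<Rightarrow> complex mat) \<Rightarrow> (nat \<Rightarrow> complex mat) \<Rightarrow>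
   diagram \<Rightarrow> complex mat" where
  "diagram_operator N d \<rho> e w =
     foldr (\<lambda>c M. chord_operator N d \<rho> e c * M) (chords w) (1\<^sub>m (tensor_dim N d))"

definition free_weight_operator ::
  "nat \<Rightarrow> (nat \<Rightarrow> nat) \<Rightarrow> (nat \<Rightarrow> complex mat \<Rightarrow> complex mat) \<Rightarrow> (nat \<Rightarrow> complex mat) \<Rightarrow>
   (diagram \<Rightarrow>\<^sub>0 complex) \<Rightarrow> complex mat" where
  "free_weight_operator N d \<rho> e x = (let D = tensor_dim N d in
     \<Oplus>\<^bsub>module_mat TYPE(complex) D D\<^esub> w\<in>Poly_Mapping.keys x.
       Poly_Mapping.lookup x w \<cdot>\<^sub>m diagram_operator N d \<rho> e w)"

text \<open>The common value of the operator on all representatives of the coset \<open>X\<close>.\<close>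

definition weight_operator ::
  "nat \<Rightarrow> (nat \<Rightarrow> nat) \<Rightarrow> (nat \<Rightarrow> complex mat \<Rightarrow> complex mat) \<Rightarrow> (nat \<Rightarrow> complex mat) \<Rightarrow>
   (diagram \<Rightarrow>\<^sub>0 complex) set \<Rightarrow> complex mat" where
  "weight_operator N d \<rho> e X = the_elem (free_weight_operator N d \<rho> e ` X)"

definition weight_system ::
  "nat \<Rightarrow> (nat \<Rightarrow> nat) \<Rightarrow> (nat \<Rightarrow> complex mat \<Rightarrow> complex mat) \<Rightarrow> (nat \<Rightarrow> complex mat) \<Rightarrow>
   (diagram \<Rightarrow>\<^sub>0 complex) set \<Rightarrow> complex" where
  "weight_system N d \<rho> e X = mat_trace (weight_operator N d \<rho> e X)"

end

theory Submission
  imports Defs "Jordan_Normal_Form.Schur_Decomposition"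
begin

text \<open>On each strand the highest weight string of the \<open>sl\<^sub>2\<close>-representation yields a positive definite
  matrix \<open>P\<close> with \<open>\<rho> A P = P (\<rho> (A\<^sup>\<dagger>))\<^sup>\<dagger>\<close>. Since the chord operators do not depend on the orthonormal
  basis and the adjoints \<open>e\<^sub>r\<^sup>\<dagger>\<close> form an orthonormal basis too, the tensor product of these forms, again
  called \<open>P\<close>, satisfies \<open>C P = P C\<^sup>\<dagger>\<close> for every chord operator \<open>C\<close>. Reversing a diagram therefore takes
  its operator to the adjoint with respect to \<open>P\<close>, and writing \<open>P = S S\<^sup>\<dagger>\<close> and
  \<open>P\<^sup>-\<^sup>1 = R R\<^sup>\<dagger>\<close> turns the weight of \<open>x x\<^sup>\<star>\<close>, with \<open>M\<close> the operator of \<open>x\<close>, into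
  \<open>Tr (M P M\<^sup>\<dagger> P\<^sup>-\<^sup>1) = Tr (Y Y\<^sup>\<dagger>) \<ge> 0\<close> for \<open>Y = R\<^sup>\<dagger> M S\<close>. The 4T relation holds because a chord operator
  commutes with the joint action of \<open>gl\<^sub>2\<close> on its two strands.\<close>

section \<open>Adjoints, traces and sums of matrices\<close>

text \<open>No inner product is given with the data: \<open>young_rep\<close> admits every matrix
  realisation, so \<open>\<rho> A\<close> and \<open>\<rho> (A\<^sup>\<dagger>)\<close> are in
  general not adjoint for the standard form, and a positive form has to be extracted from the
  representation itself. It is the form invariant under the compact real form u(2). Irreducibility
  serves to make the string span the space. The identity matrix acts by a real scalar, which is why
  the form found for sl_2 also serves gl_2.

  Orthonormality refers to a bilinear form, so the \<open>e r\<close> may be far from Hermitian and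
  a single summand of a chord operator need not be self-adjoint for \<open>P\<close>; only the whole
  sum, the split Casimir element, is.

  Positive definiteness is never carried along as a property. What travels is the pair of
  rectangular factors \<open>S\<close>, \<open>R\<close> with
  \<open>P = S * S\<^sup>\<dagger>\<close> and \<open>R * R\<^sup>\<dagger>\<close> inverse to it.
  Both can be read off from the string, both pass to tensor products strand by strand through
  Kronecker products, and together they turn the final trace into a sum of squares without any
  spectral theory.\<close>

notation mat_adjoint (\<open>_\<^sup>\<dagger>\<close> [1000] 1000)

lemma dim_adjoint [simp]: "dim_row (A\<^sup>\<dagger>) = dim_col A" "dim_col (A\<^sup>\<dagger>) = dim_row A"
  by (simp_all add: mat_adjoint_def)

lemma index_adjoint [simp]:
  fixes A :: "complex mat"
  assumes "i < dim_col A" "j < dim_row A"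
  shows "A\<^sup>\<dagger> $$ (i, j) = cnj (A $$ (j, i))"
  using assms by (simp add: mat_adjoint_def mat_of_rows_def conjugate_complex_def)

lemma adjoint_carrier [simp]: "A \<in> carrier_mat n m \<Longrightarrow> A\<^sup>\<dagger> \<in> carrier_mat m n"
  by (auto intro: carrier_matI)

lemma adjoint_adjoint [simp]: "A\<^sup>\<dagger>\<^sup>\<dagger> = (A :: complex mat)"
  by (rule eq_matI) auto

lemma adjoint_mult:
  fixes A B :: "complex mat"
  assumes "A \<in> carrier_mat n m" "B \<in> carrier_mat m k"
  shows "(A * B)\<^sup>\<dagger> = B\<^sup>\<dagger> * A\<^sup>\<dagger>"
  using assms by (intro eq_matI) (auto simp: scalar_prod_def mult.commute)

lemma adjoint_add:
  fixes A B :: "complex mat"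
  assumes "A \<in> carrier_mat n m" "B \<in> carrier_mat n m"
  shows "(A + B)\<^sup>\<dagger> = A\<^sup>\<dagger> + B\<^sup>\<dagger>"
  using assms by (intro eq_matI) auto

lemma adjoint_smult: "(c \<cdot>\<^sub>m A)\<^sup>\<dagger> = cnj c \<cdot>\<^sub>m (A :: complex mat)\<^sup>\<dagger>"
  by (rule eq_matI) auto

lemma adjoint_one [simp]: "(1\<^sub>m n :: complex mat)\<^sup>\<dagger> = 1\<^sub>m n"
  by (rule eq_matI) auto

lemma index_mult_mat_sum:
  assumes "A \<in> carrier_mat n m" "B \<in> carrier_mat m k" "i < n" "j < k"
  shows "(A * B) $$ (i, j) = (\<Sum>l<m. A $$ (i, l) * B $$ (l, j))"
  using assms by (auto simp: scalar_prod_def atLeast0LessThan)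

lemma mat_trace_mult_commute:
  assumes "A \<in> carrier_mat n m" "B \<in> carrier_mat m n"
  shows "mat_trace (A * B) = mat_trace (B * A)"
proof -
  have "mat_trace (A * B) = (\<Sum>i<n. \<Sum>j<m. A $$ (i, j) * B $$ (j, i))"
    using assms by (simp add: mat_trace_def scalar_prod_def atLeast0LessThan)
  also have "\<dots> = (\<Sum>j<m. \<Sum>i<n. B $$ (j, i) * A $$ (i, j))"
    by (subst sum.swap) (simp add: mult.commute)
  also have "\<dots> = mat_trace (B * A)"
    using assms by (simp add: mat_trace_def scalar_prod_def atLeast0LessThan)
  finally show ?thesis .
qed

lemma mat_trace_add:
  assumes "A \<in> carrier_mat n n" "B \<in> carrier_mat n n"
  shows "mat_trace (A + B) = mat_trace A + mat_trace B"
  using assms by (simp add: mat_trace_def sum.distrib)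

lemma mat_trace_diff:
  assumes "A \<in> carrier_mat n n" "B \<in> carrier_mat n n"
  shows "mat_trace (A - B) = mat_trace A - mat_trace B"
  using assms by (simp add: mat_trace_def sum_subtractf)

lemma mat_trace_smult:
  assumes "A \<in> carrier_mat n n"
  shows "mat_trace (c \<cdot>\<^sub>m A) = c * mat_trace A"
  using assms by (simp add: mat_trace_def sum_distrib_left)

lemma mat_trace_adjoint:
  assumes "A \<in> carrier_mat n n"
  shows "mat_trace (A\<^sup>\<dagger>) = cnj (mat_trace A)"
  using assms by (simp add: mat_trace_def)

text \<open>The trace is the squared Frobenius norm of \<open>A\<close>, a sum of squared moduli of
  entries. \<open>A\<close> may be rectangular.\<close>

lemma mat_trace_mult_adjoint_nonneg:
  "mat_trace (A * A\<^sup>\<dagger>) \<in> \<real> \<and> Re (mat_trace (A * A\<^sup>\<dagger>)) \<ge> 0"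
proof -
  have "mat_trace (A * A\<^sup>\<dagger>)
      = (\<Sum>i<dim_row A. \<Sum>j<dim_col A. A $$ (i, j) * cnj (A $$ (i, j)))"
    by (simp add: mat_trace_def scalar_prod_def atLeast0LessThan)
  also have "\<dots> = of_real (\<Sum>i<dim_row A. \<Sum>j<dim_col A. (cmod (A $$ (i, j)))\<^sup>2)"
    by (simp add: complex_norm_square flip: of_real_power)
  finally show ?thesis
    by (simp add: sum_nonneg)
qed

section \<open>Sums of square matrices of a fixed size\<close>

definition mat_sum :: "nat \<Rightarrow> ('i \<Rightarrow> complex mat) \<Rightarrow> 'i set \<Rightarrow> complex mat" where
  "mat_sum n f I = mat n n (\<lambda>ij. \<Sum>r\<in>I. f r $$ ij)"

lemma mat_sum_carrier [simp]: "mat_sum n f I \<in> carrier_mat n n"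
  by (simp add: mat_sum_def)

lemma dim_mat_sum [simp]: "dim_row (mat_sum n f I) = n" "dim_col (mat_sum n f I) = n"
  by (simp_all add: mat_sum_def)

lemma index_mat_sum [simp]:
  "i < n \<Longrightarrow> j < n \<Longrightarrow> mat_sum n f I $$ (i, j) = (\<Sum>r\<in>I. f r $$ (i, j))"
  by (simp add: mat_sum_def)

lemma mat_sum_cong [cong]:
  "I = J \<Longrightarrow> (\<And>r. r \<in> J \<Longrightarrow> f r = g r) \<Longrightarrow> mat_sum n f I = mat_sum n g J"
  by (simp add: mat_sum_def cong: sum.cong)

lemma mat_sum_empty [simp]: "mat_sum n f {} = 0\<^sub>m n n"
  by (rule eq_matI) auto

lemma mat_sum_insert:
  assumes "finite I" "r \<notin> I" "f r \<in> carrier_mat n n"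
  shows "mat_sum n f (insert r I) = f r + mat_sum n f I"
  using assms by (intro eq_matI) auto

lemma finsum_eq_mat_sum:
  assumes "finite I" "\<And>r. r \<in> I \<Longrightarrow> f r \<in> carrier_mat n n"
  shows "finsum (module_mat TYPE(complex) n n) f I = mat_sum n f I"
proof -
  interpret vectorspace class_ring "module_mat TYPE(complex) n n"
    by (rule matrix_vs)
  show ?thesis
    using assms
  proof (induction I rule: finite_induct)
    case empty
    then show ?case
      by (simp add: matrix_vs_simps)
  next
    case (insert r I)
    then have "finsum (module_mat TYPE(complex) n n) f (insert r I)
        = f r + finsum (module_mat TYPE(complex) n n) f I"
      by (subst finsum_insert) (auto simp: module_mat_simps)
    with insert show ?case
      by (simp add: mat_sum_insert)
  qed
qed

lemma mat_sum_add:
  assumes "\<And>r. r \<in> I \<Longrightarrow> f r \<in> carrier_mat n n" "\<And>r. r \<in> I \<Longrightarrow> g r \<in> carrier_mat n n"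
  shows "mat_sum n (\<lambda>r. f r + g r) I = mat_sum n f I + mat_sum n g I"
proof (rule eq_matI, goal_cases)
  case (1 i j)
  with assms have "\<And>r. r \<in> I \<Longrightarrow> (f r + g r) $$ (i, j) = f r $$ (i, j) + g r $$ (i, j)"
    by (metis carrier_matD index_add_mat(1) dim_mat_sum index_add_mat(2,3))
  with 1 show ?case
    by (simp add: sum.distrib)
qed auto

lemma mult_mat_sum:
  assumes "A \<in> carrier_mat n n" "\<And>r. r \<in> I \<Longrightarrow> f r \<in> carrier_mat n n"
  shows "A * mat_sum n f I = mat_sum n (\<lambda>r. A * f r) I"
proof (rule eq_matI, goal_cases)
  case (1 i j)
  with assms have *: "\<And>r. r \<in> I \<Longrightarrow> (A * f r) $$ (i, j) = (\<Sum>k<n. A $$ (i, k) * f r $$ (k, j))"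
    by (intro index_mult_mat_sum[of _ n n _ n]) auto
  have "(A * mat_sum n f I) $$ (i, j) = (\<Sum>k<n. \<Sum>r\<in>I. A $$ (i, k) * f r $$ (k, j))"
    using 1 assms by (auto simp: scalar_prod_def atLeast0LessThan sum_distrib_left)
  also have "\<dots> = (\<Sum>r\<in>I. (A * f r) $$ (i, j))"
    by (subst sum.swap) (simp add: *)
  finally show ?case
    using 1 by simp
qed (use assms in auto)

lemma mat_sum_mult:
  assumes "A \<in> carrier_mat n n" "\<And>r. r \<in> I \<Longrightarrow> f r \<in> carrier_mat n n"
  shows "mat_sum n f I * A = mat_sum n (\<lambda>r. f r * A) I"
proof (rule eq_matI, goal_cases)
  case (1 i j)
  with assms have *: "\<And>r. r \<in> I \<Longrightarrow> (f r * A) $$ (i, j) = (\<Sum>k<n. f r $$ (i, k) * A $$ (k, j))"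
    by (intro index_mult_mat_sum[of _ n n _ n]) auto
  have "(mat_sum n f I * A) $$ (i, j) = (\<Sum>k<n. \<Sum>r\<in>I. f r $$ (i, k) * A $$ (k, j))"
    using 1 assms by (auto simp: scalar_prod_def atLeast0LessThan sum_distrib_right)
  also have "\<dots> = (\<Sum>r\<in>I. (f r * A) $$ (i, j))"
    by (subst sum.swap) (simp add: *)
  finally show ?case
    using 1 by simp
qed (use assms in auto)

lemma mat_sum_swap:
  "mat_sum n (\<lambda>r. mat_sum n (f r) J) I = mat_sum n (\<lambda>s. mat_sum n (\<lambda>r. f r s) I) J"
  by (rule eq_matI) (auto intro: sum.swap)

lemma adjoint_mat_sum:
  assumes "\<And>r. r \<in> I \<Longrightarrow> f r \<in> carrier_mat n n"
  shows "(mat_sum n f I)\<^sup>\<dagger> = mat_sum n (\<lambda>r. (f r)\<^sup>\<dagger>) I"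
proof (rule eq_matI, goal_cases)
  case (1 i j)
  with assms have "\<And>r. r \<in> I \<Longrightarrow> (f r)\<^sup>\<dagger> $$ (i, j) = cnj (f r $$ (j, i))"
    by (metis carrier_matD index_adjoint dim_mat_sum)
  with 1 show ?case
    by simp
qed auto

section \<open>Kronecker products\<close>

lemma dim_kron [simp]:
  "dim_row (A \<otimes>\<^sub>k B) = dim_row A * dim_row B" "dim_col (A \<otimes>\<^sub>k B) = dim_col A * dim_col B"
  by (simp_all add: kron_def)

lemma index_kron [simp]:
  "i < dim_row A * dim_row B \<Longrightarrow> j < dim_col A * dim_col B \<Longrightarrow>
    (A \<otimes>\<^sub>k B) $$ (i, j)
      = A $$ (i div dim_row B, j div dim_col B) * B $$ (i mod dim_row B, j mod dim_col B)"
  by (simp add: kron_def)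

lemma div_mod_less_mult:
  fixes i a b :: nat
  assumes "i < a * b"
  shows "i div b < a" "i mod b < b"
proof -
  have "b > 0"
    using assms by (cases b) auto
  then show "i div b < a" "i mod b < b"
    using assms by (auto simp: less_mult_imp_div_less)
qed

lemma kron_carrier [simp]:
  "A \<in> carrier_mat n m \<Longrightarrow> B \<in> carrier_mat p q \<Longrightarrow> A \<otimes>\<^sub>k B \<in> carrier_mat (n * p) (m * q)"
  by (auto intro: carrier_matI)

text \<open>The pair (i, j) is encoded as i * b + j, the indexing of \<open>kron\<close>. Cutting
  the range into a blocks of length b separates quotient and remainder.\<close>

lemma sum_div_mod:
  fixes f :: "nat \<Rightarrow> nat \<Rightarrow> 'a :: comm_monoid_add"
  shows "(\<Sum>k<a * b. f (k div b) (k mod b)) = (\<Sum>i<a. \<Sum>j<b. f i j)"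
proof -
  have "(\<Sum>j = i * b..<i * b + b. f (j div b) (j mod b)) = (\<Sum>j<b. f i j)" for i
    by (subst sum.atLeastLessThan_shift_0) (auto simp: atLeast0LessThan intro!: sum.cong)
  then show ?thesis
    using sum.nat_group[of "\<lambda>k. f (k div b) (k mod b)" b a] by (simp add: mult.commute)
qed

text \<open>The mixed product property: the contracted index splits into a quotient and a remainder
  by \<open>sum_div_mod\<close>, and the resulting double sum factors.\<close>

lemma kron_mult:
  assumes "A \<in> carrier_mat n m" "C \<in> carrier_mat m k" "B \<in> carrier_mat p q" "D \<in> carrier_mat q r"
  shows "(A \<otimes>\<^sub>k B) * (C \<otimes>\<^sub>k D) = (A * C) \<otimes>\<^sub>k (B * D)"
proof (rule eq_matI, goal_cases)
  case (1 i j)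
  with assms have ij: "i < n * p" "j < k * r"
    by auto
  note less = div_mod_less_mult[OF ij(1)] div_mod_less_mult[OF ij(2)]
  have "((A \<otimes>\<^sub>k B) * (C \<otimes>\<^sub>k D)) $$ (i, j)
      = (\<Sum>l<m * q. (A $$ (i div p, l div q) * B $$ (i mod p, l mod q))
          * (C $$ (l div q, j div r) * D $$ (l mod q, j mod r)))"
    using ij assms by (auto simp: scalar_prod_def atLeast0LessThan intro!: sum.cong)
  also have "\<dots> = (\<Sum>s<m. \<Sum>t<q. (A $$ (i div p, s) * B $$ (i mod p, t))
          * (C $$ (s, j div r) * D $$ (t, j mod r)))"
    by (rule sum_div_mod)
  also have "\<dots> = (\<Sum>s<m. A $$ (i div p, s) * C $$ (s, j div r))
      * (\<Sum>t<q. B $$ (i mod p, t) * D $$ (t, j mod r))"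
    by (simp add: sum_product mult_ac)
  also have "\<dots> = ((A * C) \<otimes>\<^sub>k (B * D)) $$ (i, j)"
    using ij less assms by (auto simp: scalar_prod_def atLeast0LessThan)
  finally show ?case .
qed (use assms in auto)

lemma kron_add_left:
  assumes "A \<in> carrier_mat n m" "A' \<in> carrier_mat n m"
  shows "(A + A') \<otimes>\<^sub>k B = A \<otimes>\<^sub>k B + A' \<otimes>\<^sub>k B"
  using assms by (intro eq_matI) (auto simp: div_mod_less_mult algebra_simps)

lemma kron_add_right:
  assumes "B \<in> carrier_mat n m" "B' \<in> carrier_mat n m"
  shows "A \<otimes>\<^sub>k (B + B') = A \<otimes>\<^sub>k B + A \<otimes>\<^sub>k B'"
  using assms by (intro eq_matI) (auto simp: div_mod_less_mult algebra_simps)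

lemma kron_smult_left: "(c \<cdot>\<^sub>m A) \<otimes>\<^sub>k B = c \<cdot>\<^sub>m (A \<otimes>\<^sub>k B)"
  by (intro eq_matI) (auto simp: div_mod_less_mult algebra_simps)

lemma kron_smult_right: "A \<otimes>\<^sub>k (c \<cdot>\<^sub>m B) = c \<cdot>\<^sub>m (A \<otimes>\<^sub>k B)"
  by (intro eq_matI) (auto simp: div_mod_less_mult algebra_simps)

lemma adjoint_kron: "(A \<otimes>\<^sub>k B)\<^sup>\<dagger> = A\<^sup>\<dagger> \<otimes>\<^sub>k B\<^sup>\<dagger>"
  by (intro eq_matI) (auto simp: div_mod_less_mult)

lemma kron_one: "1\<^sub>m n \<otimes>\<^sub>k 1\<^sub>m m = 1\<^sub>m (n * m)"
proof (rule eq_matI, goal_cases)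
  case (1 i j)
  then have "i < n * m" "j < n * m"
    by auto
  moreover have "i = j \<longleftrightarrow> i div m = j div m \<and> i mod m = j mod m"
    by (metis div_mult_mod_eq)
  ultimately show ?case
    by (auto simp: div_mod_less_mult)
qed auto

lemma kron_one_one [simp]: "A \<otimes>\<^sub>k 1\<^sub>m (Suc 0) = A"
  by (intro eq_matI) auto

lemma kron_list_Nil [simp]: "kron_list [] = 1\<^sub>m 1"
  by (simp add: kron_list_def)

lemma kron_list_Cons [simp]: "kron_list (A # As) = A \<otimes>\<^sub>k kron_list As"
  by (simp add: kron_list_def)

lemma kron_list_map_carrier:
  assumes "\<And>k. k \<in> set ks \<Longrightarrow> f k \<in> carrier_mat (a k) (b k)"
  shows "kron_list (map f ks) \<in> carrier_mat (prod_list (map a ks)) (prod_list (map b ks))"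
  using assms by (induction ks) auto

text \<open>Three size functions are allowed because the factors of the invariant forms are
  rectangular: on strand k they have d k rows but another number of columns.\<close>

lemma kron_list_map_mult:
  assumes "\<And>k. k \<in> set ks \<Longrightarrow> f k \<in> carrier_mat (a k) (b k)"
    and "\<And>k. k \<in> set ks \<Longrightarrow> g k \<in> carrier_mat (b k) (c k)"
  shows "kron_list (map f ks) * kron_list (map g ks) = kron_list (map (\<lambda>k. f k * g k) ks)"
  using assms
proof (induction ks)
  case (Cons k ks)
  then have "f k \<in> carrier_mat (a k) (b k)" "g k \<in> carrier_mat (b k) (c k)"
    and "kron_list (map f ks) \<in> carrier_mat (prod_list (map a ks)) (prod_list (map b ks))"
    and "kron_list (map g ks) \<in> carrier_mat (prod_list (map b ks)) (prod_list (map c ks))"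
    by (auto intro: kron_list_map_carrier)
  then have "kron_list (map f (k # ks)) * kron_list (map g (k # ks))
      = (f k * g k) \<otimes>\<^sub>k (kron_list (map f ks) * kron_list (map g ks))"
    by (simp add: kron_mult)
  also have "kron_list (map f ks) * kron_list (map g ks) = kron_list (map (\<lambda>k. f k * g k) ks)"
    using Cons.prems by (intro Cons.IH) auto
  finally show ?case
    by simp
qed auto

lemma kron_list_map_one:
  "kron_list (map (\<lambda>k. 1\<^sub>m (a k)) ks) = 1\<^sub>m (prod_list (map a ks))"
  by (induction ks) (auto simp: kron_one)

lemma adjoint_kron_list_map:
  "(kron_list (map f ks))\<^sup>\<dagger> = kron_list (map (\<lambda>k. (f k)\<^sup>\<dagger>) ks)"
  by (induction ks) (auto simp: adjoint_kron)

text \<open>The tensor product is multilinear. Since the indices are distinct, the update at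
  \<open>k\<close> changes exactly one factor, so the claim descends to a product of two
  factors.\<close>

lemma kron_list_map_update_add:
  assumes "distinct ks" "k \<in> set ks"
    and "\<And>l. l \<in> set ks \<Longrightarrow> f l \<in> carrier_mat (a l) (b l)"
    and "A \<in> carrier_mat (a k) (b k)" "B \<in> carrier_mat (a k) (b k)"
  shows "kron_list (map (f(k := A + B)) ks)
    = kron_list (map (f(k := A)) ks) + kron_list (map (f(k := B)) ks)"
  using assms
proof (induction ks)
  case (Cons l ks)
  show ?case
  proof (cases "l = k")
    case True
    with Cons.prems(1) have "kron_list (map (f(k := M)) ks) = kron_list (map f ks)" for M
      by (auto intro!: arg_cong[of _ _ kron_list])
    with True Cons.prems show ?thesis
      by (simp add: kron_add_left fun_upd_same del: fun_upd_apply)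
  next
    case False
    with Cons.prems have "kron_list (map (f(k := M)) ks)
        \<in> carrier_mat (prod_list (map a ks)) (prod_list (map b ks))"
      if "M \<in> carrier_mat (a k) (b k)" for M
      using that by (intro kron_list_map_carrier) auto
    note * = kron_add_right[OF this[OF Cons.prems(4)] this[OF Cons.prems(5)]]
    have "kron_list (map (f(k := A + B)) ks)
        = kron_list (map (f(k := A)) ks) + kron_list (map (f(k := B)) ks)"
      using False Cons.prems by (intro Cons.IH) auto
    with False * show ?thesis
      by (simp del: fun_upd_apply add: fun_upd_other)
  qed
qed simp

lemma kron_list_map_update_smult:
  assumes "distinct ks" "k \<in> set ks"
  shows "kron_list (map (f(k := c \<cdot>\<^sub>m A)) ks) = c \<cdot>\<^sub>m kron_list (map (f(k := A)) ks)"
  using assms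
proof (induction ks)
  case (Cons l ks)
  show ?case
  proof (cases "l = k")
    case True
    with Cons.prems(1) have "kron_list (map (f(k := M)) ks) = kron_list (map f ks)" for M
      by (auto intro!: arg_cong[of _ _ kron_list])
    with True show ?thesis
      by (simp add: kron_smult_left fun_upd_same del: fun_upd_apply)
  next
    case False
    with Cons show ?thesis
      by (simp add: kron_smult_right)
  qed
qed simp

section \<open>Invariant forms on irreducible representations of \<open>sl\<^sub>2\<close>\<close>

lemma smult_mat_mult_vec: "(k \<cdot>\<^sub>m A) *\<^sub>v v = k \<cdot>\<^sub>v (A *\<^sub>v (v :: complex vec))" if "dim_col A = dim_vec v"
  using that by (intro eq_vecI) auto

lemma cscalar_prod_adjoint:
  fixes A :: "complex mat"
  assumes "A \<in> carrier_mat n k" "w \<in> carrier_vec n" "x \<in> carrier_vec k"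
  shows "w \<bullet>c (A *\<^sub>v x) = (A\<^sup>\<dagger> *\<^sub>v w) \<bullet>c x"
proof -
  have "w \<bullet>c (A *\<^sub>v x) = (\<Sum>i<n. \<Sum>j<k. w $ i * cnj (A $$ (i, j) * x $ j))"
    using assms by (auto simp: scalar_prod_def atLeast0LessThan sum_distrib_left)
  also have "\<dots> = (\<Sum>j<k. \<Sum>i<n. cnj (A $$ (i, j)) * w $ i * cnj (x $ j))"
    by (subst sum.swap) (simp add: mult_ac)
  also have "\<dots> = (A\<^sup>\<dagger> *\<^sub>v w) \<bullet>c x"
    using assms by (auto simp: scalar_prod_def atLeast0LessThan sum_distrib_right)
  finally show ?thesis .
qed

text \<open>The brackets [E, F] = H and [H, F] = -2 F are stated without subtraction, ready to move
  \<open>F\<close> to the left past \<open>E\<close> and \<open>H\<close>. Irreducibility is kept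
  outside; it enters later as the assumption that the string spans.\<close>

locale highest_weight_string =
  fixes d m :: nat and E F H :: "complex mat" and v :: "complex vec"
  assumes E: "E \<in> carrier_mat d d" and F: "F \<in> carrier_mat d d" and H: "H \<in> carrier_mat d d"
    and EF: "E * F = F * E + H" and HF: "H * F = F * H + (-2) \<cdot>\<^sub>m F"
    and v: "v \<in> carrier_vec d" "v \<noteq> 0\<^sub>v d"
    and Ev: "E *\<^sub>v v = 0\<^sub>v d" and Hv: "H *\<^sub>v v = of_nat m \<cdot>\<^sub>v v"
begin

definition u :: "nat \<Rightarrow> complex vec" where
  "u k = ((*\<^sub>v) F ^^ k) v"

lemma u_0: "u 0 = v" and u_Suc: "u (Suc k) = F *\<^sub>v u k"
  by (simp_all add: u_def)

lemma u_carrier [simp]: "u k \<in> carrier_vec d"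
  using F v by (induction k) (auto simp: u_0 u_Suc)

lemma dim_u [simp]: "dim_vec (u k) = d"
  using u_carrier[of k] by auto

text \<open>H F = F (H - 2), so each application of \<open>F\<close> lowers the eigenvalue by
  2.\<close>

lemma H_u: "H *\<^sub>v u k = (of_nat m - 2 * of_nat k) \<cdot>\<^sub>v u k"
proof (induction k)
  case 0
  then show ?case
    by (simp add: u_0 Hv)
next
  case (Suc k)
  have "H *\<^sub>v u (Suc k) = (H * F) *\<^sub>v u k"
    using H F by (simp add: u_Suc assoc_mult_mat_vec[OF H F])
  also have "\<dots> = F *\<^sub>v (H *\<^sub>v u k) + (-2) \<cdot>\<^sub>v (F *\<^sub>v u k)"
    using H F unfolding HF
    by (subst add_mult_distrib_mat_vec[where nr = d and nc = d])
      (auto simp: smult_mat_mult_vec assoc_mult_mat_vec[OF F H])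
  also have "\<dots> = (of_nat m - 2 * of_nat (Suc k)) \<cdot>\<^sub>v u (Suc k)"
    unfolding Suc mult_mat_vec[OF F u_carrier] u_Suc[symmetric]
    by (intro eq_vecI) (auto simp: algebra_simps)
  finally show ?case .
qed

text \<open>Moving \<open>E\<close> past each \<open>F\<close> leaves an \<open>H\<close> behind, so
  the coefficient is the sum of the weights m - 2 j over j \<le> k, which equals (k + 1) (m -
  k).\<close>

lemma E_u_Suc: "E *\<^sub>v u (Suc k) = (of_nat (Suc k) * (of_nat m - of_nat k)) \<cdot>\<^sub>v u k"
proof (induction k)
  have "E *\<^sub>v u (Suc k) = F *\<^sub>v (E *\<^sub>v u k) + H *\<^sub>v u k" for k
  proof -
    have "E *\<^sub>v u (Suc k) = (E * F) *\<^sub>v u k"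
      by (simp add: u_Suc assoc_mult_mat_vec[OF E F])
    also have "\<dots> = F *\<^sub>v (E *\<^sub>v u k) + H *\<^sub>v u k"
      using E F H unfolding EF
      by (subst add_mult_distrib_mat_vec[where nr = d and nc = d])
        (auto simp: assoc_mult_mat_vec[OF F E])
    finally show ?thesis .
  qed
  note step = this
  case 0
  have "F *\<^sub>v 0\<^sub>v d = 0\<^sub>v d"
    using F by (intro eq_vecI) auto
  then show ?case
    using v by (simp add: step u_0 Ev Hv)
  case (Suc k)
  show ?case
    unfolding step[of "Suc k"] Suc mult_mat_vec[OF F u_carrier] u_Suc[symmetric] H_u
    by (intro eq_vecI) (auto simp: algebra_simps)
qed

text \<open>Past the weight \<open>-m\<close> the string never returns to zero once it is non-zero, which would
  give \<open>H\<close> infinitely many eigenvalues.\<close>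

lemma u_top: "u (Suc m) = 0\<^sub>v d"
proof (rule ccontr)
  assume top: "u (Suc m) \<noteq> 0\<^sub>v d"
  have "u (Suc m + k) \<noteq> 0\<^sub>v d" for k
  proof (induction k)
    case (Suc k)
    show ?case
    proof
      assume "u (Suc m + Suc k) = 0\<^sub>v d"
      then have "E *\<^sub>v u (Suc (Suc m + k)) = 0\<^sub>v d"
        using E by (intro eq_vecI) auto
      then have *: "\<And>i. i < d \<Longrightarrow>
          (of_nat (Suc (Suc m + k)) * (of_nat m - of_nat (Suc m + k)) :: complex) * u (Suc m + k) $ i = 0"
        unfolding E_u_Suc by (metis dim_u index_smult_vec(1) index_zero_vec(1))
      \<comment> \<open>The second factor is -(k + 1), so \<open>E\<close> sends the next vector of
        the string to a non-zero multiple of the present one, which therefore vanishes as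
        well.\<close>
      have "of_nat (Suc (Suc m + k)) * (of_nat m - of_nat (Suc m + k)) \<noteq> (0 :: complex)"
        by (metis add_Suc_shift eq_iff_diff_eq_0 less_add_Suc1 less_not_refl mult_eq_0_iff
            of_nat_eq_0_iff of_nat_eq_iff old.nat.distinct(2))
      with * have "u (Suc m + k) = 0\<^sub>v d"
        by (intro eq_vecI) (metis dim_u index_zero_vec(1,2) mult_eq_0_iff, simp)
      with Suc show False
        by simp
    qed
  qed (use top in simp)
  then have "eigenvector H (u (Suc m + k)) (of_nat m - 2 * of_nat (Suc m + k))" for k
    using H by (simp add: eigenvector_def H_u)
  then have "poly (char_poly H) (of_nat m - 2 * of_nat (Suc m + k)) = 0" for k
    using eigenvalue_root_char_poly[OF H] by (auto simp: eigenvalue_def)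
  then have "range (\<lambda>k. of_nat m - 2 * of_nat (Suc m + k)) \<subseteq> {x :: complex. poly (char_poly H) x = 0}"
    by auto
  moreover have "char_poly H \<noteq> 0"
    using degree_monic_char_poly[OF H] by auto
  ultimately have "finite (range (\<lambda>k. of_nat m - 2 * of_nat (Suc m + k) :: complex))"
    using poly_roots_finite finite_subset by blast
  moreover have "inj (\<lambda>k. of_nat m - 2 * of_nat (Suc m + k) :: complex)"
    by (rule injI) simp
  ultimately show False
    using finite_imageD by blast
qed

text \<open>The span of the string is handled as \<open>range comb\<close>, so that membership
  supplies explicit coefficients. Only the values of \<open>c\<close> up to \<open>m\<close>
  matter.\<close>

definition comb :: "(nat \<Rightarrow> complex) \<Rightarrow> complex vec" where
  "comb c = vec d (\<lambda>i. \<Sum>k\<le>m. c k * u k $ i)"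

lemma smult_u_in_comb:
  assumes "k \<le> m"
  shows "a \<cdot>\<^sub>v u k \<in> range comb"
proof
  have "(\<Sum>j\<le>m. (if j = k then a else 0) * u j $ i) = a * u k $ i" for i
    using assms by (simp add: if_distrib[of "\<lambda>x. x * _"] cong: if_cong)
  then show "a \<cdot>\<^sub>v u k = comb (\<lambda>j. if j = k then a else 0)"
    by (intro eq_vecI) (auto simp: comb_def)
qed simp

lemma zero_in_comb: "0\<^sub>v d \<in> range comb"
proof
  show "0\<^sub>v d = comb (\<lambda>_. 0)"
    by (intro eq_vecI) (auto simp: comb_def)
qed simp

lemma mult_comb_in_comb:
  assumes M: "M \<in> carrier_mat d d" and "\<And>k. k \<le> m \<Longrightarrow> M *\<^sub>v u k \<in> range comb"
  shows "M *\<^sub>v comb c \<in> range comb"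
proof -
  have "\<forall>k. \<exists>t. k \<le> m \<longrightarrow> M *\<^sub>v u k = comb t"
    using assms(2) by blast
  then obtain t where t: "\<And>k. k \<le> m \<Longrightarrow> M *\<^sub>v u k = comb (t k)"
    by metis
  have "M *\<^sub>v comb c = comb (\<lambda>j. \<Sum>k\<le>m. c k * t k j)"
  proof (rule eq_vecI)
    fix i assume "i < dim_vec (comb (\<lambda>j. \<Sum>k\<le>m. c k * t k j))"
    then have i: "i < d"
      by (simp add: comb_def)
    have "(M *\<^sub>v comb c) $ i = (\<Sum>l<d. \<Sum>k\<le>m. M $$ (i, l) * (c k * u k $ l))"
      using M i by (simp add: comb_def scalar_prod_def atLeast0LessThan sum_distrib_left)
    also have "\<dots> = (\<Sum>k\<le>m. c k * (M *\<^sub>v u k) $ i)"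
      using M i by (subst sum.swap)
        (simp add: scalar_prod_def atLeast0LessThan sum_distrib_left mult_ac)
    also have "\<dots> = (\<Sum>k\<le>m. \<Sum>j\<le>m. c k * t k j * u j $ i)"
      using i by (simp add: t) (simp add: comb_def sum_distrib_left mult_ac)
    also have "\<dots> = comb (\<lambda>j. \<Sum>k\<le>m. c k * t k j) $ i"
      using i by (subst sum.swap) (simp add: comb_def sum_distrib_right)
    finally show "(M *\<^sub>v comb c) $ i = comb (\<lambda>j. \<Sum>k\<le>m. c k * t k j) $ i" .
  qed (use M in \<open>simp add: comb_def\<close>)
  then show ?thesis
    by blast
qed

text \<open>\<open>H\<close> scales each vector of the string, \<open>E\<close> steps down and kills
  u_0, \<open>F\<close> steps up. Truncation at \<open>m\<close> is harmless because
  \<open>F\<close> kills u_m by \<open>u_top\<close>.\<close>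

lemma comb_invariant:
  "E *\<^sub>v comb c \<in> range comb" "F *\<^sub>v comb c \<in> range comb" "H *\<^sub>v comb c \<in> range comb"
proof -
  show "E *\<^sub>v comb c \<in> range comb"
  proof (rule mult_comb_in_comb[OF E])
    fix k assume "k \<le> m"
    then show "E *\<^sub>v u k \<in> range comb"
      by (cases k) (auto simp: E_u_Suc u_0 Ev zero_in_comb smult_u_in_comb)
  qed
  show "F *\<^sub>v comb c \<in> range comb"
  proof (rule mult_comb_in_comb[OF F])
    fix k assume "k \<le> m"
    then show "F *\<^sub>v u k \<in> range comb"
      using smult_u_in_comb[of "Suc k" 1] u_top zero_in_comb
      by (cases "k = m") (auto simp: u_Suc[symmetric])
  qed
  show "H *\<^sub>v comb c \<in> range comb"
    by (rule mult_comb_in_comb[OF H]) (auto simp: H_u smult_u_in_comb)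
qed

lemma subspace_comb:
  "VectorSpace.subspace class_ring (range comb) (module_vec TYPE(complex) d)"
proof -
  interpret vec_space "TYPE(complex)" d .
  have add: "comb a + comb b = comb (\<lambda>k. a k + b k)" for a b
    by (intro eq_vecI) (auto simp: comb_def sum.distrib algebra_simps)
  have smult: "x \<cdot>\<^sub>v comb a = comb (\<lambda>k. x * a k)" for a x
    by (intro eq_vecI) (auto simp: comb_def sum_distrib_left mult_ac)
  have carrier: "comb a \<in> carrier_vec d" for a
    by (simp add: comb_def)
  show ?thesis
    unfolding VectorSpace.subspace_def
  proof
    show "vectorspace class_ring (module_vec TYPE(complex) d)"
      by (rule vec_vs)
    show "submodule class_ring (range comb) (module_vec TYPE(complex) d)"
      using zero_in_comb
      by (intro submodule.intro vec_module)
        (auto simp: module_vec_simps class_ring_simps add smult carrier)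
  qed
qed

text \<open>The weights that make \<open>E\<close> and \<open>F\<close> adjoint to each other for the form
  \<open>P = \<Sum>k\<le>m. norm_factor k u\<^sub>k u\<^sub>k\<^sup>\<dagger>\<close>.\<close>

definition norm_factor :: "nat \<Rightarrow> real" where
  "norm_factor k = 1 / (\<Prod>l<k. (real l + 1) * (real m - real l))"

text \<open>All l < k satisfy l < m, so every factor of the product is positive. Positivity of the
  form thus rests on the highest weight being a natural number.\<close>

lemma norm_factor_pos: "k \<le> m \<Longrightarrow> norm_factor k > 0"
  unfolding norm_factor_def by (intro divide_pos_pos prod_pos ballI mult_pos_pos) auto

text \<open>This recursion is what \<open>F * P = P * E\<^sup>\<dagger>\<close> demands: the
  coefficients of \<open>u (k + 1) * (u k)\<^sup>\<dagger>\<close> on the two sides are the weight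
  at k and the weight at k + 1 times (k + 1) (m - k).\<close>

lemma norm_factor_Suc:
  "k < m \<Longrightarrow> norm_factor (Suc k) * ((real k + 1) * (real m - real k)) = norm_factor k"
  by (simp add: norm_factor_def)

text \<open>The columns are the vectors of the string, scaled by the square roots of the weights, so
  the form is born together with a factorisation.\<close>

definition S :: "complex mat" where
  "S = mat d (Suc m) (\<lambda>(i, k). of_real (sqrt (norm_factor k)) * u k $ i)"

lemma S_carrier [simp]: "S \<in> carrier_mat d (Suc m)"
  by (simp add: S_def)

lemma index_S [simp]:
  "i < d \<Longrightarrow> k < Suc m \<Longrightarrow> S $$ (i, k) = of_real (sqrt (norm_factor k)) * u k $ i"
  by (simp add: S_def)

lemma index_mult_S:
  assumes "M \<in> carrier_mat d d" "i < d" "k < Suc m"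
  shows "(M * S) $$ (i, k) = of_real (sqrt (norm_factor k)) * (M *\<^sub>v u k) $ i"
  using assms by (subst index_mult_mat_sum[where n = d and m = d and k = "Suc m"])
    (auto simp: scalar_prod_def atLeast0LessThan sum_distrib_left mult_ac)

definition P :: "complex mat" where
  "P = S * S\<^sup>\<dagger>"

lemma P_carrier [simp]: "P \<in> carrier_mat d d"
  unfolding P_def by (rule mult_carrier_mat[OF S_carrier adjoint_carrier[OF S_carrier]])

lemma dim_S [simp]: "dim_row S = d" "dim_col S = Suc m"
  and dim_P [simp]: "dim_row P = d" "dim_col P = d"
  using S_carrier P_carrier by (auto simp del: S_carrier P_carrier)

lemma P_adjoint: "P\<^sup>\<dagger> = P"
  by (simp add: P_def adjoint_mult[OF S_carrier adjoint_carrier[OF S_carrier]])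

lemma sqrt_norm_factor:
  assumes "k \<le> m"
  shows "(of_real (sqrt (norm_factor k)) * x) * (of_real (sqrt (norm_factor k)) * y)
    = of_real (norm_factor k) * (x * y :: complex)"
proof -
  have "of_real (sqrt (norm_factor k)) * of_real (sqrt (norm_factor k))
      = (of_real (norm_factor k) :: complex)"
    using norm_factor_pos[OF assms] by (simp flip: of_real_mult)
  then show ?thesis
    by (metis mult.assoc mult.left_commute)
qed

text \<open>Entrywise version of the rank-one expansion
  \<open>M * P = \<Sum> norm_factor k * (M u_k) * u_k\<^sup>\<dagger>\<close>. It reduces every
  relation for \<open>P\<close> to the action of a matrix on the string.\<close>

lemma index_mult_P:
  assumes M: "M \<in> carrier_mat d d" and "i < d" "j < d"
  shows "(M * P) $$ (i, j)
    = (\<Sum>k\<le>m. of_real (norm_factor k) * ((M *\<^sub>v u k) $ i * cnj (u k $ j)))"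
proof -
  have "M * P = (M * S) * S\<^sup>\<dagger>"
    unfolding P_def by (rule assoc_mult_mat[symmetric, OF M S_carrier adjoint_carrier[OF S_carrier]])
  also have "\<dots> $$ (i, j) = (\<Sum>k<Suc m. (M * S) $$ (i, k) * S\<^sup>\<dagger> $$ (k, j))"
    using assms by (intro index_mult_mat_sum[where n = d and k = d])
      (auto simp: adjoint_carrier intro: mult_carrier_mat[OF M S_carrier])
  also have "\<dots> = (\<Sum>k<Suc m. of_real (norm_factor k) * ((M *\<^sub>v u k) $ i * cnj (u k $ j)))"
  proof (rule sum.cong)
    fix k assume k: "k \<in> {..<Suc m}"
    then have "S\<^sup>\<dagger> $$ (k, j) = of_real (sqrt (norm_factor k)) * cnj (u k $ j)"
      using assms by simp
    with k assms show "(M * S) $$ (i, k) * S\<^sup>\<dagger> $$ (k, j)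
        = of_real (norm_factor k) * ((M *\<^sub>v u k) $ i * cnj (u k $ j))"
      by (simp only: index_mult_S lessThan_iff less_Suc_eq_le sqrt_norm_factor)
  qed simp
  finally show ?thesis
    by (simp only: lessThan_Suc_atMost)
qed

text \<open>\<open>P\<close> is Hermitian. A relation \<open>N * P = P * M\<^sup>\<dagger>\<close>
  thereby becomes a comparison of \<open>N * P\<close> with the adjoint of \<open>M * P\<close>, and
  both of these expand along the string.\<close>

lemma P_mult_adjoint: 
  assumes M: "M \<in> carrier_mat d d"
  shows "P * M\<^sup>\<dagger> = (M * P)\<^sup>\<dagger>"
  by (simp add: adjoint_mult[OF M P_carrier] P_adjoint)

text \<open>The eigenvalues m - 2 k of \<open>H\<close> on the string are real, so conjugation
  leaves them unchanged.\<close>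

lemma H_P: "H * P = P * H\<^sup>\<dagger>"
  unfolding P_mult_adjoint[OF H] using H
  by (intro eq_matI) (auto simp: index_mult_P[OF H] H_u mult_ac simp del: index_mult_mat(1) index_mult_mat_vec)

lemma F_P: "F * P = P * E\<^sup>\<dagger>"
  unfolding P_mult_adjoint[OF E]
proof (rule eq_matI)
  fix i j assume "i < dim_row ((E * P)\<^sup>\<dagger>)" "j < dim_col ((E * P)\<^sup>\<dagger>)"
  then have ij: "i < d" "j < d"
    using E by auto
  \<comment> \<open>The summand k = m has dropped out, since \<open>F\<close> kills the end of the
    string.\<close>
  have "(F * P) $$ (i, j)
      = (\<Sum>k<m. of_real (norm_factor k) * (u (Suc k) $ i * cnj (u k $ j)))"
    using ij by (simp add: index_mult_P[OF F] u_top flip: u_Suc lessThan_Suc_atMost)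
  also have "\<dots> = (\<Sum>k<m. of_real (norm_factor (Suc k)) *
      (u (Suc k) $ i * cnj ((E *\<^sub>v u (Suc k)) $ j)))"
  proof (rule sum.cong)
    fix k assume k: "k \<in> {..<m}"
    then have "(of_real (norm_factor k) :: complex)
        = of_real (norm_factor (Suc k)) * ((of_nat k + 1) * (of_nat m - of_nat k))"
      by (simp flip: norm_factor_Suc)
    then show "of_real (norm_factor k) * (u (Suc k) $ i * cnj (u k $ j))
        = of_real (norm_factor (Suc k)) * (u (Suc k) $ i * cnj ((E *\<^sub>v u (Suc k)) $ j))"
      using ij by (simp add: E_u_Suc mult_ac del: index_mult_mat_vec)
  qed simp
  \<comment> \<open>The index is shifted by one; the new summand k = 0 vanishes because
    \<open>E\<close> kills the highest weight vector.\<close>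
  also have "\<dots> = (\<Sum>k<Suc m. of_real (norm_factor k) * (u k $ i * cnj ((E *\<^sub>v u k) $ j)))"
    using ij by (subst sum.lessThan_Suc_shift) (simp add: u_0 Ev del: index_mult_mat_vec)
  also have "\<dots> = (E * P)\<^sup>\<dagger> $$ (i, j)"
    using ij E by (simp add: index_mult_P[OF E] lessThan_Suc_atMost mult_ac del: index_mult_mat(1) index_mult_mat_vec)
  finally show "(F * P) $$ (i, j) = (E * P)\<^sup>\<dagger> $$ (i, j)" .
qed (use E F in auto)

lemma E_P: "E * P = P * F\<^sup>\<dagger>"
  unfolding P_mult_adjoint[OF F] F_P P_mult_adjoint[OF E] by simp

text \<open>For w in the kernel of \<open>P\<close> the squared norm of
  \<open>S\<^sup>\<dagger> w\<close> is the pairing of w with P w, hence 0, so w is orthogonal to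
  the whole string. If the string spans, w is a combination of these vectors and orthogonal to
  itself.\<close>

lemma det_P:
  assumes span: "range comb = carrier_vec d"
  shows "det P \<noteq> 0"
proof
  assume "det P = 0"
  then obtain w where w: "w \<in> carrier_vec d" "w \<noteq> 0\<^sub>v d" "P *\<^sub>v w = 0\<^sub>v d"
    using det_0_iff_vec_prod_zero[OF P_carrier] by auto
  have Sw_carrier: "S\<^sup>\<dagger> *\<^sub>v w \<in> carrier_vec (Suc m)"
    using w by (intro mult_mat_vec_carrier[of _ _ d] adjoint_carrier S_carrier)
  have "(S\<^sup>\<dagger> *\<^sub>v w) \<bullet>c (S\<^sup>\<dagger> *\<^sub>v w) = w \<bullet>c (S *\<^sub>v (S\<^sup>\<dagger> *\<^sub>v w))"
    by (simp add: cscalar_prod_adjoint[OF S_carrier w(1) Sw_carrier])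
  also have "S *\<^sub>v (S\<^sup>\<dagger> *\<^sub>v w) = 0\<^sub>v d"
    using w(3) unfolding P_def
    by (simp add: assoc_mult_mat_vec[OF S_carrier adjoint_carrier[OF S_carrier] w(1)])
  finally have Sw: "S\<^sup>\<dagger> *\<^sub>v w = 0\<^sub>v (Suc m)"
    using w Sw_carrier by (simp add: conjugate_square_eq_0_vec)
  have "(\<Sum>i<d. cnj (u k $ i) * w $ i) = 0" if k: "k \<le> m" for k
  proof -
    have "(S\<^sup>\<dagger> *\<^sub>v w) $ k = of_real (sqrt (norm_factor k)) * (\<Sum>i<d. cnj (u k $ i) * w $ i)"
      using w k S_carrier by (simp add: scalar_prod_def atLeast0LessThan sum_distrib_left mult_ac)
    with Sw k norm_factor_pos[OF k] show ?thesis
      by simp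
  qed
  note orthogonal = this
  obtain c where c: "w = comb c"
    using w span by blast
  have "(\<Sum>i<d. cnj (w $ i) * w $ i) = (\<Sum>i<d. \<Sum>k\<le>m. cnj (c k) * (cnj (u k $ i) * w $ i))"
  proof (rule sum.cong)
    fix i assume "i \<in> {..<d}"
    then have "w $ i = (\<Sum>k\<le>m. c k * u k $ i)"
      by (simp add: c comb_def)
    then have "cnj (w $ i) = (\<Sum>k\<le>m. cnj (c k) * cnj (u k $ i))"
      by simp
    then show "cnj (w $ i) * w $ i = (\<Sum>k\<le>m. cnj (c k) * (cnj (u k $ i) * w $ i))"
      by (simp add: sum_distrib_right mult.assoc)
  qed simp
  also have "\<dots> = (\<Sum>k\<le>m. cnj (c k) * (\<Sum>i<d. cnj (u k $ i) * w $ i))"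
    by (subst sum.swap) (simp add: sum_distrib_left)
  also have "\<dots> = 0"
    by (simp add: orthogonal)
  finally have "(\<Sum>i<d. cnj (w $ i) * w $ i) = 0" .
  then have "w \<bullet>c w = 0"
    using w by (simp add: scalar_prod_def atLeast0LessThan mult.commute)
  with w show False
    by simp
qed

text \<open>The witness is R = Q S for the inverse Q of \<open>P\<close>. As Q is Hermitian,
  \<open>R * R\<^sup>\<dagger> = Q * P * Q = Q\<close>, so the factorisation of \<open>P\<close>
  yields one of its inverse, with the same number of columns.\<close>

lemma invariant_form:
  assumes "range comb = carrier_vec d"
  obtains R where "R \<in> carrier_mat d (Suc m)" "P * (R * R\<^sup>\<dagger>) = 1\<^sub>m d"
proof -
  have "P \<in> Units (ring_mat TYPE(complex) d ())"
    by (rule det_non_zero_imp_unit[OF P_carrier det_P[OF assms]])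
  then obtain Q where Q: "Q \<in> carrier_mat d d" "P * Q = 1\<^sub>m d" "Q * P = 1\<^sub>m d"
    by (auto simp: Units_def ring_mat_simps)
  have "Q\<^sup>\<dagger> = Q"
  proof -
    have "Q\<^sup>\<dagger> * P = 1\<^sub>m d"
      using adjoint_mult[OF P_carrier Q(1)] by (simp add: Q(2) P_adjoint)
    moreover have "Q\<^sup>\<dagger> * P * Q = Q\<^sup>\<dagger> * (P * Q)"
      using Q(1) by (intro assoc_mult_mat[of _ d d, OF _ P_carrier Q(1)]) simp
    ultimately show ?thesis
      using Q(1,2) by simp
  qed
  note S' = adjoint_carrier[OF S_carrier]
  have "(Q * S) * (Q * S)\<^sup>\<dagger> = (Q * S) * (S\<^sup>\<dagger> * Q)"
    by (simp add: adjoint_mult[OF Q(1) S_carrier] \<open>Q\<^sup>\<dagger> = Q\<close>)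
  also have "\<dots> = Q * (S * (S\<^sup>\<dagger> * Q))"
    by (rule assoc_mult_mat[OF Q(1) S_carrier mult_carrier_mat[OF S' Q(1)]])
  also have "\<dots> = Q * (P * Q)"
    by (simp add: P_def assoc_mult_mat[OF S_carrier S' Q(1)])
  finally have "P * ((Q * S) * (Q * S)\<^sup>\<dagger>) = 1\<^sub>m d"
    using Q by simp
  moreover have "Q * S \<in> carrier_mat d (Suc m)"
    using Q(1) S_carrier by (rule mult_carrier_mat)
  ultimately show ?thesis
    by (rule that[rotated])
qed

end

section \<open>From the string to arbitrary elements of sl_2\<close>

definition sl2_F :: "complex mat" where
  "sl2_F = mat_of_rows_list 2 [[0, 0], [1, 0]]"

lemmas sl2_defs = sl2_E_def sl2_F_def sl2_H_def mat_of_rows_list_def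

lemma sl2_basis [simp]:
  "sl2_E \<in> sl2" "sl2_F \<in> sl2" "sl2_H \<in> sl2"
  by (auto simp: sl2_def gl2_def sl2_defs mat_trace_def numeral_2_eq_2)

lemma sl2_carrier: "A \<in> sl2 \<Longrightarrow> A \<in> carrier_mat 2 2"
  by (simp add: sl2_def gl2_def)

lemma sl2_brackets:
  "sl2_E * sl2_F - sl2_F * sl2_E = sl2_H"
  "sl2_H * sl2_F - sl2_F * sl2_H = (-2) \<cdot>\<^sub>m sl2_F"
  by (auto intro!: eq_matI simp: sl2_defs scalar_prod_def numeral_2_eq_2 less_Suc_eq)

lemma sl2_smult: "A \<in> sl2 \<Longrightarrow> c \<cdot>\<^sub>m A \<in> sl2"
  by (auto simp: sl2_def gl2_def mat_trace_smult)

lemma sl2_add: "A \<in> sl2 \<Longrightarrow> B \<in> sl2 \<Longrightarrow> A + B \<in> sl2"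
  by (auto simp: sl2_def gl2_def mat_trace_add)

lemma sl2_expansion:
  assumes "A \<in> sl2"
  shows "A = A $$ (0, 0) \<cdot>\<^sub>m sl2_H + (A $$ (0, 1) \<cdot>\<^sub>m sl2_E + A $$ (1, 0) \<cdot>\<^sub>m sl2_F)"
proof -
  have "A \<in> carrier_mat 2 2" "A $$ (1, 1) = - (A $$ (0, 0))"
    using assms by (auto simp: sl2_def gl2_def mat_trace_def numeral_2_eq_2 eq_neg_iff_add_eq_0 add.commute)
  then show ?thesis
    by (intro eq_matI) (auto simp: sl2_defs numeral_2_eq_2 less_Suc_eq)
qed

text \<open>The relation \<open>M * P = P * M'\<^sup>\<dagger>\<close> is additive in the pair (M,
  M') and, by \<open>mult_adjoint_smult\<close>, scales by c on \<open>M\<close> and by its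
  conjugate on \<open>M'\<close>. Hence generators suffice: E, F, H for the Lie algebra, monomials
  for the free algebra.\<close>

lemma mult_adjoint_add:
  fixes M N P :: "complex mat"
  assumes "P \<in> carrier_mat n n"
    and "M \<in> carrier_mat n n" "M' \<in> carrier_mat n n" "M * P = P * M'\<^sup>\<dagger>"
    and "N \<in> carrier_mat n n" "N' \<in> carrier_mat n n" "N * P = P * N'\<^sup>\<dagger>"
  shows "(M + N) * P = P * (M' + N')\<^sup>\<dagger>"
proof -
  have "(M + N) * P = M * P + N * P"
    using assms by (intro add_mult_distrib_mat) auto
  also have "\<dots> = P * (M'\<^sup>\<dagger> + N'\<^sup>\<dagger>)"
    unfolding assms(4,7) using assms by (intro mult_add_distrib_mat[symmetric]) auto
  finally show ?thesis
    using assms by (simp add: adjoint_add)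
qed

lemma mult_adjoint_smult:
  fixes M P :: "complex mat"
  assumes "P \<in> carrier_mat n n"
    and "M \<in> carrier_mat n n" "M' \<in> carrier_mat n n" "M * P = P * M'\<^sup>\<dagger>"
  shows "(c \<cdot>\<^sub>m M) * P = P * (cnj c \<cdot>\<^sub>m M')\<^sup>\<dagger>"
proof -
  have "(c \<cdot>\<^sub>m M) * P = c \<cdot>\<^sub>m (M * P)"
    using assms by (intro mult_smult_assoc_mat) auto
  also have "\<dots> = P * (c \<cdot>\<^sub>m M'\<^sup>\<dagger>)"
    unfolding assms(4) using assms by (intro mult_smult_distrib[symmetric]) auto
  finally show ?thesis
    by (simp add: adjoint_smult)
qed

lemma sl2_irrep_invariant_form:
  assumes "sl2_irrep m d \<sigma>"
  obtains S R where "S \<in> carrier_mat d (Suc m)" "R \<in> carrier_mat d (Suc m)"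
    "(S * S\<^sup>\<dagger>) * (R * R\<^sup>\<dagger>) = 1\<^sub>m d"
    "\<And>A. A \<in> sl2 \<Longrightarrow> \<sigma> A * (S * S\<^sup>\<dagger>) = (S * S\<^sup>\<dagger>) * (\<sigma> (A\<^sup>\<dagger>))\<^sup>\<dagger>"
proof -
  obtain v where v: "v \<in> carrier_vec d" "v \<noteq> 0\<^sub>v d" "\<sigma> sl2_E *\<^sub>v v = 0\<^sub>v d" "\<sigma> sl2_H *\<^sub>v v = of_nat m \<cdot>\<^sub>v v"
    and irred: "irreducible_lie_rep sl2 d \<sigma>"
    using assms by (auto simp: sl2_irrep_def)
  then have rep: "lie_rep sl2 d \<sigma>"
    by (simp add: irreducible_lie_rep_def)
  have carrier: "\<sigma> A \<in> carrier_mat d d" and smult: "\<sigma> (c \<cdot>\<^sub>m A) = c \<cdot>\<^sub>m \<sigma> A" if "A \<in> sl2" for A c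
    using rep that by (auto simp: lie_rep_def)
  have add: "\<sigma> (A + B) = \<sigma> A + \<sigma> B" and bracket: "\<sigma> (A * B - B * A) = \<sigma> A * \<sigma> B - \<sigma> B * \<sigma> A"
    if "A \<in> sl2" "B \<in> sl2" for A B
    using rep that by (auto simp: lie_rep_def)
  have eq_add: "X = Y + Z" if "X - Y = Z" "X \<in> carrier_mat d d" "Y \<in> carrier_mat d d" for X Y Z :: "complex mat"
    using that by (intro eq_matI) auto
  interpret highest_weight_string d m "\<sigma> sl2_E" "\<sigma> sl2_F" "\<sigma> sl2_H" v
  proof
    show "\<sigma> sl2_E * \<sigma> sl2_F = \<sigma> sl2_F * \<sigma> sl2_E + \<sigma> sl2_H"
      using bracket[of sl2_E sl2_F] carrier
      by (intro eq_add) (auto simp: sl2_brackets intro!: mult_carrier_mat[of _ d d _ d])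
    show "\<sigma> sl2_H * \<sigma> sl2_F = \<sigma> sl2_F * \<sigma> sl2_H + (-2) \<cdot>\<^sub>m \<sigma> sl2_F"
      using bracket[of sl2_H sl2_F] carrier
      by (intro eq_add) (auto simp: sl2_brackets smult intro!: mult_carrier_mat[of _ d d _ d])
  qed (use v carrier in auto)
  have expand: "\<sigma> A = A $$ (0, 0) \<cdot>\<^sub>m \<sigma> sl2_H + (A $$ (0, 1) \<cdot>\<^sub>m \<sigma> sl2_E + A $$ (1, 0) \<cdot>\<^sub>m \<sigma> sl2_F)"
    if "A \<in> sl2" for A
    by (subst sl2_expansion[OF that]) (simp add: add smult sl2_add sl2_smult)
  have "\<sigma> A *\<^sub>v w \<in> range comb" if A: "A \<in> sl2" and w: "w \<in> range comb" for A w
  proof -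
    interpret W: submodule class_ring "range comb" "module_vec TYPE(complex) d"
      using subspace_comb by (simp add: VectorSpace.subspace_def)
    have closed: "x + y \<in> range comb" "c \<cdot>\<^sub>v x \<in> range comb"
      if "x \<in> range comb" "y \<in> range comb" for x y c
      using W.m_closed[of x y] W.smult_closed[of c x] that
      by (simp_all add: module_vec_simps class_ring_simps)
    have "w \<in> carrier_vec d"
      using w by (auto simp: comb_def)
    then have "\<sigma> A *\<^sub>v w = A $$ (0, 0) \<cdot>\<^sub>v (\<sigma> sl2_H *\<^sub>v w)
        + (A $$ (0, 1) \<cdot>\<^sub>v (\<sigma> sl2_E *\<^sub>v w) + A $$ (1, 0) \<cdot>\<^sub>v (\<sigma> sl2_F *\<^sub>v w))"
      using E F H by (simp add: expand[OF A] add_mult_distrib_mat_vec[of _ d d] smult_mat_mult_vec)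
    also have "\<dots> \<in> range comb"
      using w comb_invariant by (intro closed) auto
    finally show ?thesis .
  qed
  \<comment> \<open>Irreducibility enters here: the span of the string is an invariant subspace and
    contains the non-zero vector \<open>v\<close>, so it is the whole space.\<close>
  then have "range comb = {0\<^sub>v d} \<or> range comb = carrier_vec d"
    using irred subspace_comb by (auto simp: irreducible_lie_rep_def)
  moreover have "v \<in> range comb"
    using smult_u_in_comb[of 0 1] by (simp add: u_0)
  ultimately have "range comb = carrier_vec d"
    using v by auto
  then obtain R where R: "R \<in> carrier_mat d (Suc m)" "P * (R * R\<^sup>\<dagger>) = 1\<^sub>m d"
    by (rule invariant_form)
  have "\<sigma> A * P = P * (\<sigma> (A\<^sup>\<dagger>))\<^sup>\<dagger>" if A: "A \<in> sl2" for A
  proof -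
    note A' = sl2_carrier[OF A]
    have "A\<^sup>\<dagger> \<in> sl2"
      using A by (auto simp: sl2_def gl2_def mat_trace_adjoint)
    \<comment> \<open>Passing to the adjoint conjugates the coefficients and exchanges E and F. The
      summands are ordered so that they pair up with those of \<open>A\<close> as in
      \<open>H_P\<close>, \<open>E_P\<close> and \<open>F_P\<close>.\<close>
    then have "\<sigma> (A\<^sup>\<dagger>) = cnj (A $$ (0, 0)) \<cdot>\<^sub>m \<sigma> sl2_H
        + (cnj (A $$ (0, 1)) \<cdot>\<^sub>m \<sigma> sl2_F + cnj (A $$ (1, 0)) \<cdot>\<^sub>m \<sigma> sl2_E)"
      using A' E F by (subst expand) (auto simp: comm_add_mat[of _ d d])
    then show ?thesis
      unfolding expand[OF A]
      using E F H P_carrier E_P F_P H_P by (simp add: mult_adjoint_add[of _ d] mult_adjoint_smult[of _ d])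
  qed
  with R show ?thesis
    by (intro that[of S R]) (auto simp: P_def)
qed

section \<open>The star-algebra of horizontal chord diagrams\<close>

lemma poly_mapping_eq_sum_single:
  "x = (\<Sum>w\<in>Poly_Mapping.keys x. Poly_Mapping.single w (Poly_Mapping.lookup x w))"
proof (rule poly_mapping_eqI)
  fix w
  show "Poly_Mapping.lookup x w = Poly_Mapping.lookup
      (\<Sum>w\<in>Poly_Mapping.keys x. Poly_Mapping.single w (Poly_Mapping.lookup x w)) w"
    by (simp add: lookup_sum lookup_single when_def in_keys_iff)
qed

text \<open>Every element is a finite sum of monomials from its support. The set \<open>A\<close>
  remembers which monomials can occur.\<close>

lemma poly_mapping_induct_on [consumes 1, case_names zero single add]:
  fixes x :: "'k \<Rightarrow>\<^sub>0 'b :: comm_monoid_add"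
  assumes "Poly_Mapping.keys x \<subseteq> A"
    and "P 0" "\<And>w c. w \<in> A \<Longrightarrow> P (Poly_Mapping.single w c)" "\<And>x y. P x \<Longrightarrow> P y \<Longrightarrow> P (x + y)"
  shows "P x"
proof -
  have "P (\<Sum>w\<in>B. Poly_Mapping.single w (Poly_Mapping.lookup x w))" if "finite B" "B \<subseteq> A" for B
    using that by induction (simp_all add: assms)
  with assms(1) show ?thesis
    by (subst poly_mapping_eq_sum_single) simp
qed

lemmas poly_mapping_induct_add [case_names zero single add] =
  poly_mapping_induct_on[OF subset_UNIV, simplified]

text \<open>Scalars live in the algebra as multiples of the empty diagram. They are central although
  the monoid is not commutative.\<close>

lemma single_zero_mult_commute:
  "Poly_Mapping.single 0 c * x = x * Poly_Mapping.single 0 (c :: complex)"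
  by (induction x rule: poly_mapping_induct_add) (simp_all add: mult_single algebra_simps)

lemma single_zero_mult_left_commute:
  "x * (Poly_Mapping.single 0 c * y) = Poly_Mapping.single 0 (c :: complex) * (x * y)"
  by (metis mult.assoc single_zero_mult_commute)

definition rev_diagram :: "diagram \<Rightarrow> diagram" where
  "rev_diagram w = Diagram (rev (chords w))"

lemma rev_diagram_simps [simp]:
  "rev_diagram (rev_diagram w) = w" "rev_diagram 0 = 0"
  "rev_diagram (v + w) = rev_diagram w + rev_diagram v"
  "rev_diagram (Diagram [c]) = Diagram [c]"
  "rev_diagram w \<in> diagrams N \<longleftrightarrow> w \<in> diagrams N"
  by (simp_all add: rev_diagram_def zero_diagram_def plus_diagram_def diagrams_def)

text \<open>Summation over any finite superset of the support allows x, y and x + y to be compared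
  over one index set; additivity is obtained in this way.\<close>

lemma free_star_superset:
  assumes "finite A" "Poly_Mapping.keys x \<subseteq> A"
  shows "free_star x
    = (\<Sum>w\<in>A. Poly_Mapping.single (rev_diagram w) (cnj (Poly_Mapping.lookup x w)))"
  unfolding free_star_def rev_diagram_def
  using assms by (intro sum.mono_neutral_left) (auto simp: in_keys_iff)

lemma free_star_single:
  "free_star (Poly_Mapping.single w c) = Poly_Mapping.single (rev_diagram w) (cnj c)"
  by (subst free_star_superset[of "{w}"]) auto

lemma free_star_zero: "free_star 0 = 0"
  by (simp add: free_star_def)

lemma free_star_add: "free_star (x + y) = free_star x + free_star y"
proof -
  let ?A = "Poly_Mapping.keys x \<union> Poly_Mapping.keys y"
  have "free_star z = (\<Sum>w\<in>?A. Poly_Mapping.single (rev_diagram w) (cnj (Poly_Mapping.lookup z w)))"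
    if "z = x \<or> z = y \<or> z = x + y" for z
    using that Poly_Mapping.keys_add[of x y] by (intro free_star_superset) auto
  then show ?thesis
    by (simp add: lookup_add single_add sum.distrib)
qed

lemma free_star_uminus: "free_star (- x) = - free_star x"
  using free_star_add[of x "- x"] by (simp add: free_star_zero add_eq_0_iff)

lemma free_star_diff: "free_star (x - y) = free_star x - free_star y"
  using free_star_add[of x "- y"] by (simp add: free_star_uminus)

lemma free_star_free_star: "free_star (free_star x) = x"
  by (induction x rule: poly_mapping_induct_add)
    (simp_all add: free_star_zero free_star_single free_star_add)

lemma free_star_mult: "free_star (x * y) = free_star y * free_star x"
proof (induction x rule: poly_mapping_induct_add)
  case (single v c)
  show ?case
    by (induction y rule: poly_mapping_induct_add)
      (simp_all add: free_star_zero free_star_single free_star_add mult_single algebra_simps)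
qed (simp_all add: free_star_zero free_star_add algebra_simps)

lemma free_star_one: "free_star 1 = 1"
  using free_star_single[of 0 1] by simp

lemma free_star_chord: "free_star (chord i j) = chord i j"
  by (simp add: chord_def free_star_single)

lemma keys_free_star: "Poly_Mapping.keys (free_star x) \<subseteq> rev_diagram ` Poly_Mapping.keys x"
proof -
  have "Poly_Mapping.keys (free_star x)
      \<subseteq> (\<Union>w\<in>Poly_Mapping.keys x. Poly_Mapping.keys (Poly_Mapping.single (rev_diagram w) (cnj (Poly_Mapping.lookup x w))))"
    unfolding free_star_def rev_diagram_def by (rule Poly_Mapping.keys_sum)
  also have "\<dots> \<subseteq> rev_diagram ` Poly_Mapping.keys x"
    by (auto split: if_splits)
  finally show ?thesis .
qed

lemma diagrams_closed: "0 \<in> diagrams N" "v \<in> diagrams N \<Longrightarrow> w \<in> diagrams N \<Longrightarrow> v + w \<in> diagrams N"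
  by (auto simp: diagrams_def zero_diagram_def plus_diagram_def)

lemma free_algebra_simps:
  "carrier (free_algebra N) = {x. Poly_Mapping.keys x \<subseteq> diagrams N}"
  "monoid.mult (free_algebra N) = (*)" "one (free_algebra N) = 1"
  "zero (free_algebra N) = 0" "add (free_algebra N) = (+)"
  by (simp_all add: free_algebra_def)

lemma free_algebra_closed:
  assumes "x \<in> carrier (free_algebra N)" "y \<in> carrier (free_algebra N)"
  shows "x + y \<in> carrier (free_algebra N)" "x * y \<in> carrier (free_algebra N)"
    "- x \<in> carrier (free_algebra N)" "x - y \<in> carrier (free_algebra N)"
    "free_star x \<in> carrier (free_algebra N)"
proof -
  have x: "Poly_Mapping.keys x \<subseteq> diagrams N" and y: "Poly_Mapping.keys y \<subseteq> diagrams N"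
    using assms by (simp_all add: free_algebra_simps)
  show "x + y \<in> carrier (free_algebra N)" "- x \<in> carrier (free_algebra N)"
    "x - y \<in> carrier (free_algebra N)"
    using x y Poly_Mapping.keys_add[of x y] keys_diff[of x y] by (auto simp: free_algebra_simps)
  have "{a + b |a b. a \<in> Poly_Mapping.keys x \<and> b \<in> Poly_Mapping.keys y} \<subseteq> diagrams N"
    using x y by (auto intro: diagrams_closed)
  then show "x * y \<in> carrier (free_algebra N)"
    using keys_mult[of x y] by (simp add: free_algebra_simps)
  have "rev_diagram ` Poly_Mapping.keys x \<subseteq> diagrams N"
    using x by auto
  then show "free_star x \<in> carrier (free_algebra N)"
    using keys_free_star[of x] by (simp add: free_algebra_simps)
qed

lemma single_zero_closed: "Poly_Mapping.single 0 c \<in> carrier (free_algebra N)"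
  by (simp add: free_algebra_simps diagrams_closed)

interpretation free: ring "free_algebra N" for N
proof (rule ringI)
  show "abelian_group (free_algebra N)"
  proof (rule abelian_groupI)
    fix x assume "x \<in> carrier (free_algebra N)"
    then show "\<exists>y\<in>carrier (free_algebra N). y \<oplus>\<^bsub>free_algebra N\<^esub> x = \<zero>\<^bsub>free_algebra N\<^esub>"
      by (intro bexI[of _ "- x"]) (auto simp: free_algebra_closed free_algebra_simps(5,4))
  qed (auto simp: free_algebra_simps(5,4) free_algebra_closed algebra_simps, simp add: free_algebra_simps)
  show "Group.monoid (free_algebra N)"
  proof (rule monoidI)
    show "\<one>\<^bsub>free_algebra N\<^esub> \<in> carrier (free_algebra N)"
      using single_zero_closed[of 1 N] by (simp add: free_algebra_simps(3))
  qed (auto simp: free_algebra_simps(2,3) free_algebra_closed algebra_simps)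
qed (auto simp: free_algebra_simps(2,5) algebra_simps)

section \<open>The braid ideal and its stability under reversal\<close>

lemma chord_closed:
  assumes "i \<in> {1..N}" "j \<in> {1..N}" "i \<noteq> j"
  shows "chord i j \<in> carrier (free_algebra N)"
  using assms by (auto simp: chord_def free_algebra_simps diagrams_def)

lemma braid_relations_closed: "braid_relations N \<subseteq> carrier (free_algebra N)"
  unfolding braid_relations_def by (auto intro!: free_algebra_closed chord_closed)

lemma ideal_braid_ideal: "ideal (braid_ideal N) (free_algebra N)"
  unfolding braid_ideal_def by (rule free.genideal_ideal[OF braid_relations_closed])

lemma braid_ideal_minimal:
  "ideal J (free_algebra N) \<Longrightarrow> braid_relations N \<subseteq> J \<Longrightarrow> braid_ideal N \<subseteq> J"
  unfolding braid_ideal_def by (rule free.genideal_minimal)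

lemma braid_relations_subset: "braid_relations N \<subseteq> braid_ideal N"
  unfolding braid_ideal_def by (rule free.genideal_self[OF braid_relations_closed])

lemma free_algebra_uminus:
  "x \<in> carrier (free_algebra N) \<Longrightarrow> \<ominus>\<^bsub>free_algebra N\<^esub> x = - x"
  by (rule free.minus_equality) (auto simp: free_algebra_simps(4,5) free_algebra_closed)

lemma braid_ideal_closed:
  assumes "x \<in> braid_ideal N"
  shows "x \<in> carrier (free_algebra N)" "- x \<in> braid_ideal N"
    and "y \<in> braid_ideal N \<Longrightarrow> x + y \<in> braid_ideal N"
    and "y \<in> braid_ideal N \<Longrightarrow> x - y \<in> braid_ideal N"
    and "a \<in> carrier (free_algebra N) \<Longrightarrow> a * x \<in> braid_ideal N"
    and "a \<in> carrier (free_algebra N) \<Longrightarrow> x * a \<in> braid_ideal N"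
proof -
  interpret ideal "braid_ideal N" "free_algebra N"
    by (rule ideal_braid_ideal)
  show carrier: "x \<in> carrier (free_algebra N)"
    using assms by (rule Icarr)
  have uminus: "- y \<in> braid_ideal N" if "y \<in> braid_ideal N" for y
    using a_inv_closed[OF that] free_algebra_uminus[OF Icarr[OF that]] by simp
  have add: "x + y \<in> braid_ideal N" if "y \<in> braid_ideal N" for y
    using a_closed[OF assms that] by (simp add: free_algebra_simps(5))
  show "- x \<in> braid_ideal N" "y \<in> braid_ideal N \<Longrightarrow> x + y \<in> braid_ideal N"
    "y \<in> braid_ideal N \<Longrightarrow> x - y \<in> braid_ideal N"
    using uminus[OF assms] add[of y] add[of "- y"] uminus[of y] by auto
  show "a \<in> carrier (free_algebra N) \<Longrightarrow> a * x \<in> braid_ideal N"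
    and "a \<in> carrier (free_algebra N) \<Longrightarrow> x * a \<in> braid_ideal N"
    using I_l_closed[OF assms, of a] I_r_closed[OF assms, of a] by (auto simp: free_algebra_simps(2))
qed

lemma zero_in_braid_ideal: "0 \<in> braid_ideal N"
  using additive_subgroup.zero_closed[OF ideal.axioms(1)[OF ideal_braid_ideal]]
  by (simp add: free_algebra_simps(4))

lemma ideal_free_algebraI:
  assumes "J \<subseteq> carrier (free_algebra N)" "0 \<in> J" "\<And>x y. x \<in> J \<Longrightarrow> y \<in> J \<Longrightarrow> x + y \<in> J"
    and "\<And>x. x \<in> J \<Longrightarrow> - x \<in> J"
    and "\<And>a x. x \<in> J \<Longrightarrow> a \<in> carrier (free_algebra N) \<Longrightarrow> a * x \<in> J"
    and "\<And>a x. x \<in> J \<Longrightarrow> a \<in> carrier (free_algebra N) \<Longrightarrow> x * a \<in> J"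
  shows "ideal J (free_algebra N)"
proof (rule idealI)
  show "ring (free_algebra N)" ..
  show "subgroup J (add_monoid (free_algebra N))"
  proof (rule subgroup.intro)
    fix x assume "x \<in> J"
    then show "inv\<^bsub>add_monoid (free_algebra N)\<^esub> x \<in> J"
      using assms(1,4) free_algebra_uminus[of x N] by (auto simp: a_inv_def)
  qed (use assms in \<open>auto simp: free_algebra_simps(4,5)\<close>)
qed (use assms in \<open>auto simp: free_algebra_simps(2)\<close>)

text \<open>Both kinds of relation are commutators of reversal-invariant elements; 4T is the
  commutator of (i, j) with (i, k) + (j, k). Reversal turns [a, b] into [b, a] = - [a, b].\<close>

lemma free_star_braid_relations:
  assumes "x \<in> braid_relations N"
  shows "- free_star x \<in> braid_relations N \<or> free_star x \<in> braid_relations N"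
  using assms unfolding braid_relations_def
proof (elim UnE CollectE exE conjE, goal_cases)
  case (1 i j k l)
  then have "free_star x = chord k l * chord i j - chord i j * chord k l"
    by (simp add: free_star_diff free_star_mult free_star_chord)
  then have "- free_star x = chord i j * chord k l - chord k l * chord i j"
    by simp
  with 1 show ?case
    by blast
next
  case (2 i j k)
  then have "- free_star x
      = chord i j * chord i k + chord i j * chord j k - chord i k * chord i j - chord j k * chord i j"
    by (simp add: free_star_diff free_star_add free_star_mult free_star_chord)
  with 2 show ?case
    by blast
qed

text \<open>The preimage of the ideal under reversal is again a two-sided ideal, because an
  anti-automorphism exchanges left and right multiples. It contains the generators, so minimality
  applies.\<close>

lemma free_star_braid_ideal:
  assumes "x \<in> braid_ideal N"
  shows "free_star x \<in> braid_ideal N"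
proof -
  let ?J = "{x \<in> carrier (free_algebra N). free_star x \<in> braid_ideal N}"
  have "ideal ?J (free_algebra N)"
    using free.zero_closed[of N, unfolded free_algebra_simps(4)]
    by (intro ideal_free_algebraI)
      (auto simp: free_algebra_closed free_star_zero free_star_add free_star_uminus free_star_mult
        zero_in_braid_ideal intro: braid_ideal_closed)
  moreover have "braid_relations N \<subseteq> ?J"
  proof
    fix x assume x: "x \<in> braid_relations N"
    have "free_star x \<in> braid_ideal N"
      using free_star_braid_relations[OF x] braid_relations_subset[of N]
        braid_ideal_closed(2)[of "- free_star x" N] by auto
    with x braid_relations_closed[of N] show "x \<in> ?J"
      by auto
  qed
  ultimately show ?thesis
    using braid_ideal_minimal assms by blast
qed

section \<open>Cosets and the operations of the quotient\<close>

definition coset :: "nat \<Rightarrow> (diagram \<Rightarrow>\<^sub>0 complex) \<Rightarrow> (diagram \<Rightarrow>\<^sub>0 complex) set" where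
  "coset N x = braid_ideal N +>\<^bsub>free_algebra N\<^esub> x"

lemma coset_eq: "coset N x = (\<lambda>h. h + x) ` braid_ideal N"
  by (auto simp: coset_def a_r_coset_def r_coset_def free_algebra_simps)

lemma coset_cong:
  assumes "x - y \<in> braid_ideal N"
  shows "coset N x = coset N y"
proof -
  have sub: "coset N a \<subseteq> coset N b" if "a - b \<in> braid_ideal N" for a b
  proof
    fix z assume "z \<in> coset N a"
    then obtain h where h: "h \<in> braid_ideal N" "z = h + a"
      by (auto simp: coset_eq)
    then have "z = (h + (a - b)) + b"
      by simp
    with h that show "z \<in> coset N b"
      unfolding coset_eq using braid_ideal_closed(3) by blast
  qed
  show ?thesis
    using sub[of x y] sub[of y x] assms braid_ideal_closed(2)[OF assms] by simp
qed

text \<open>The star and the scalar multiplication of the quotient are unions over all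
  representatives. If \<open>f\<close> respects the ideal, all cosets in the union coincide, and
  there is at least one since x represents its own coset.\<close>

lemma UN_coset:
  assumes "\<And>h. h \<in> braid_ideal N \<Longrightarrow> f (h + x) - f x \<in> braid_ideal N"
  shows "(\<Union>y\<in>coset N x. coset N (f y)) = coset N (f x)"
proof -
  have "coset N (f y) = coset N (f x)" if "y \<in> coset N x" for y
    using that assms by (auto simp: coset_eq[of N x] intro!: coset_cong)
  moreover have "x \<in> coset N x"
    using zero_in_braid_ideal[of N] by (auto simp: coset_eq image_iff intro!: bexI[of _ 0])
  ultimately show ?thesis
    by blast
qed

lemma smult_eq: "Poly_Mapping.map ((*) c) x = Poly_Mapping.single 0 c * (x :: diagram \<Rightarrow>\<^sub>0 complex)"
  by (rule mult_map_scale_conv_mult)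

lemma carrier_chord_algebra: "carrier (chord_algebra N) = coset N ` carrier (free_algebra N)"
  by (auto simp: chord_algebra_def Let_def FactRing_def A_RCOSETS_def RCOSETS_def coset_def a_r_coset_def)

lemma chord_algebra_ops:
  "\<one>\<^bsub>chord_algebra N\<^esub> = coset N 1" "\<zero>\<^bsub>chord_algebra N\<^esub> = coset N 0"
  by (simp_all add: chord_algebra_def Let_def FactRing_def coset_def free_algebra_simps(3)
      free.a_rcos_zero[OF ideal_braid_ideal zero_in_braid_ideal])

lemma chord_algebra_add:
  "x \<in> carrier (free_algebra N) \<Longrightarrow> y \<in> carrier (free_algebra N) \<Longrightarrow>
    coset N x \<oplus>\<^bsub>chord_algebra N\<^esub> coset N y = coset N (x + y)"
  using ideal.a_rcos_sum[OF ideal_braid_ideal, of x N y]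
  by (simp add: chord_algebra_def Let_def FactRing_def coset_def free_algebra_simps(5))

lemma chord_algebra_mult:
  "x \<in> carrier (free_algebra N) \<Longrightarrow> y \<in> carrier (free_algebra N) \<Longrightarrow>
    coset N x \<otimes>\<^bsub>chord_algebra N\<^esub> coset N y = coset N (x * y)"
  using ideal.rcoset_mult_add[OF ideal_braid_ideal, of x N y]
  by (simp add: chord_algebra_def Let_def FactRing_def coset_def free_algebra_simps(2))

lemma chord_algebra_smult:
  "c \<odot>\<^bsub>chord_algebra N\<^esub> coset N x = coset N (Poly_Mapping.single 0 c * x)"
proof -
  have "c \<odot>\<^bsub>chord_algebra N\<^esub> coset N x = (\<Union>y\<in>coset N x. coset N (Poly_Mapping.single 0 c * y))"
    by (simp add: chord_algebra_def Let_def coset_def smult_eq)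
  also have "\<dots> = coset N (Poly_Mapping.single 0 c * x)"
    by (intro UN_coset) (simp add: algebra_simps braid_ideal_closed(5) single_zero_closed)
  finally show ?thesis .
qed

lemma chord_algebra_star:
  "\<star>\<^bsub>chord_algebra N\<^esub> (coset N x) = coset N (free_star x)"
proof -
  have "\<star>\<^bsub>chord_algebra N\<^esub> (coset N x) = (\<Union>y\<in>coset N x. coset N (free_star y))"
    by (simp add: chord_algebra_def Let_def coset_def)
  also have "\<dots> = coset N (free_star x)"
    by (intro UN_coset) (simp add: free_star_add free_star_braid_ideal)
  finally show ?thesis .
qed

lemmas chord_algebra_simps = carrier_chord_algebra chord_algebra_ops chord_algebra_add
  chord_algebra_mult chord_algebra_smult chord_algebra_star

lemma ring_chord_algebra: "ring (chord_algebra N)"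
proof -
  note closed = free_algebra_closed[of _ N] free.zero_closed[of N, unfolded free_algebra_simps(4)]
    free.one_closed[of N, unfolded free_algebra_simps(3)]
  show ?thesis
  proof (rule ringI)
    show "abelian_group (chord_algebra N)"
    proof (rule abelian_groupI)
      fix X assume "X \<in> carrier (chord_algebra N)"
      then obtain x where "X = coset N x" "x \<in> carrier (free_algebra N)"
        by (auto simp: carrier_chord_algebra)
      then show "\<exists>Y\<in>carrier (chord_algebra N). Y \<oplus>\<^bsub>chord_algebra N\<^esub> X = \<zero>\<^bsub>chord_algebra N\<^esub>"
        by (intro bexI[of _ "coset N (- x)"]) (auto simp: chord_algebra_simps closed)
    qed (auto simp: chord_algebra_simps closed add_ac)
    show "Group.monoid (chord_algebra N)"
      by (rule monoidI) (auto simp: chord_algebra_simps closed mult.assoc)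
  qed (auto simp: chord_algebra_simps closed algebra_simps)
qed

lemma complex_star_algebra_chord_algebra: "complex_star_algebra (chord_algebra N)"
proof -
  interpret ring "chord_algebra N"
    by (rule ring_chord_algebra)
  note closed = free_algebra_closed[of _ N] single_zero_closed[of _ N]
    free.one_closed[of N, unfolded free_algebra_simps(3)]
  interpret scal: Module.module "class_ring :: complex ring" "chord_algebra N"
    by (intro Module.module.intro module_axioms.intro abelian_group_axioms class_cring.cring_axioms)
      (auto simp: chord_algebra_simps closed class_ring_simps single_add mult_single algebra_simps
        mult.assoc[symmetric])
  show ?thesis
    by unfold_locales
      (auto simp: chord_algebra_simps closed free_star_free_star free_star_one free_star_add
        free_star_mult free_star_single mult.assoc single_zero_mult_left_commute
        simp flip: single_zero_mult_commute)
qed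

section \<open>Young diagram representations of \<open>gl\<^sub>2\<close>\<close>

lemma gl2_traceless_sl2: "A \<in> gl2 \<Longrightarrow> gl2_traceless A \<in> sl2"
  by (auto simp: gl2_traceless_def sl2_def gl2_def gl2_scalar_def mat_trace_def numeral_2_eq_2 minus_carrier_mat)

lemma gl2_traceless_adjoint:
  "A \<in> gl2 \<Longrightarrow> gl2_traceless (A\<^sup>\<dagger>) = (gl2_traceless A)\<^sup>\<dagger>"
  by (intro eq_matI)
    (auto simp: gl2_traceless_def gl2_def gl2_scalar_def mat_trace_adjoint[of A 2])

lemma gl2_traceless_add:
  "A \<in> gl2 \<Longrightarrow> B \<in> gl2 \<Longrightarrow> gl2_traceless (A + B) = gl2_traceless A + gl2_traceless B"
  by (intro eq_matI)
    (auto simp: gl2_traceless_def gl2_def gl2_scalar_def mat_trace_add[of A 2 B] add_divide_distrib)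

lemma gl2_traceless_smult:
  "A \<in> gl2 \<Longrightarrow> gl2_traceless (c \<cdot>\<^sub>m A) = c \<cdot>\<^sub>m gl2_traceless A"
  by (intro eq_matI)
    (auto simp: gl2_traceless_def gl2_def gl2_scalar_def mat_trace_smult[of A 2] algebra_simps)

lemma gl2_scalar_bracket:
  "A \<in> gl2 \<Longrightarrow> B \<in> gl2 \<Longrightarrow> gl2_scalar (A * B - B * A) = 0"
  using mat_trace_mult_commute[of A 2 2 B]
  by (auto simp: gl2_def gl2_scalar_def mat_trace_diff[of _ 2] mult_carrier_mat[of _ 2 2 _ 2])

text \<open>Scalar matrices are central, so shifts by them leave commutators alone. This serves both
  the traceless part of a matrix in gl_2 and the scalar summand of a representation.\<close>

lemma shifted_bracket:
  fixes X Y :: "complex mat"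
  assumes X: "X \<in> carrier_mat n n" and Y: "Y \<in> carrier_mat n n"
  shows "(X + a \<cdot>\<^sub>m 1\<^sub>m n) * (Y + b \<cdot>\<^sub>m 1\<^sub>m n) - (Y + b \<cdot>\<^sub>m 1\<^sub>m n) * (X + a \<cdot>\<^sub>m 1\<^sub>m n) = X * Y - Y * X"
proof -
  \<comment> \<open>Apart from \<open>X * Y\<close> the expansion is symmetric under exchanging (X,
    a) with (Y, b), so it cancels in the commutator.\<close>
  have *: "(X + a \<cdot>\<^sub>m 1\<^sub>m n) * (Y + b \<cdot>\<^sub>m 1\<^sub>m n) = X * Y + (b \<cdot>\<^sub>m X + (a \<cdot>\<^sub>m Y + (a * b) \<cdot>\<^sub>m 1\<^sub>m n))"
    if X: "X \<in> carrier_mat n n" and Y: "Y \<in> carrier_mat n n" for X Y :: "complex mat" and a b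
  proof -
    have "(X + a \<cdot>\<^sub>m 1\<^sub>m n) * (Y + b \<cdot>\<^sub>m 1\<^sub>m n) = X * (Y + b \<cdot>\<^sub>m 1\<^sub>m n) + (a \<cdot>\<^sub>m 1\<^sub>m n) * (Y + b \<cdot>\<^sub>m 1\<^sub>m n)"
      using X Y by (intro add_mult_distrib_mat) auto
    also have "X * (Y + b \<cdot>\<^sub>m 1\<^sub>m n) = X * Y + b \<cdot>\<^sub>m X"
      using X Y by (subst mult_add_distrib_mat[of _ n n]) (auto simp: mult_smult_distrib[of _ n n _ n])
    also have "(a \<cdot>\<^sub>m 1\<^sub>m n) * (Y + b \<cdot>\<^sub>m 1\<^sub>m n) = a \<cdot>\<^sub>m (Y + b \<cdot>\<^sub>m 1\<^sub>m n)"
      using Y by (subst mult_smult_assoc_mat[of _ n n _ n]) auto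
    finally show ?thesis
      using X Y by (intro eq_matI) (auto simp: algebra_simps simp del: index_mult_mat(1))
  qed
  show ?thesis
    unfolding *[OF X Y] *[OF Y X]
    using X Y by (intro eq_matI) (auto simp: algebra_simps simp del: index_mult_mat(1))
qed

text \<open>A commutator has trace zero, hence is its own traceless part, and scalar shifts of its
  arguments do not change it.\<close>

lemma gl2_traceless_bracket:
  assumes "A \<in> gl2" "B \<in> gl2"
  shows "gl2_traceless (A * B - B * A) = gl2_traceless A * gl2_traceless B - gl2_traceless B * gl2_traceless A"
proof -
  have A: "A \<in> carrier_mat 2 2" and B: "B \<in> carrier_mat 2 2"
    using assms by (simp_all add: gl2_def)
  have "gl2_traceless M = M + (- gl2_scalar M) \<cdot>\<^sub>m 1\<^sub>m 2" if "M \<in> carrier_mat 2 2" for M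
    using that by (intro eq_matI) (auto simp: gl2_traceless_def)
  then show ?thesis
    using A B gl2_scalar_bracket[OF assms] shifted_bracket[OF A B]
    by (auto intro!: eq_matI simp: mult_carrier_mat[of _ 2 2 _ 2] minus_carrier_mat simp del: index_mult_mat(1))
qed

text \<open>Kronecker products with a 1 by 1 factor collapse, so the twist by the one-dimensional
  representation just adds a scalar matrix. In particular the identity matrix acts as the
  identity.\<close>

lemma young_rep_cases:
  assumes "young_rep d \<rho>"
  shows "\<exists>m \<sigma>. sl2_irrep m d \<sigma> \<and>
    (\<forall>A\<in>gl2. \<rho> A = \<sigma> (gl2_traceless A) + gl2_scalar A \<cdot>\<^sub>m 1\<^sub>m d)"
proof -
  obtain m \<sigma> where "sl2_irrep m d \<sigma>"
    and \<rho>: "\<And>A. A \<in> gl2 \<Longrightarrow> \<rho> A = tensor_rep d (extend_rep \<sigma>) 1 (scalar_rep 1) A"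
    using assms unfolding young_rep_def by blast
  moreover have "tensor_rep d (extend_rep \<sigma>) 1 (scalar_rep 1) A
      = \<sigma> (gl2_traceless A) + gl2_scalar A \<cdot>\<^sub>m 1\<^sub>m d" for A
    by (simp add: tensor_rep_def extend_rep_def scalar_rep_def kron_smult_right)
  ultimately show ?thesis
    by auto
qed

lemma lie_rep_young_rep:
  assumes "young_rep d \<rho>"
  shows "lie_rep gl2 d \<rho>" "d > 0"
proof -
  obtain m \<sigma> where \<sigma>: "sl2_irrep m d \<sigma>"
    and \<rho>: "\<And>A. A \<in> gl2 \<Longrightarrow> \<rho> A = \<sigma> (gl2_traceless A) + gl2_scalar A \<cdot>\<^sub>m 1\<^sub>m d"
    using young_rep_cases[OF assms] by auto
  then show "d > 0"
    by (simp add: sl2_irrep_def irreducible_lie_rep_def)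
  have rep: "lie_rep sl2 d \<sigma>"
    using \<sigma> by (simp add: sl2_irrep_def irreducible_lie_rep_def)
  have carrier: "\<sigma> A \<in> carrier_mat d d" and smult: "\<sigma> (c \<cdot>\<^sub>m A) = c \<cdot>\<^sub>m \<sigma> A" if "A \<in> sl2" for A c
    using rep that by (auto simp: lie_rep_def)
  have add: "\<sigma> (A + B) = \<sigma> A + \<sigma> B" and bracket: "\<sigma> (A * B - B * A) = \<sigma> A * \<sigma> B - \<sigma> B * \<sigma> A"
    if "A \<in> sl2" "B \<in> sl2" for A B
    using rep that by (auto simp: lie_rep_def)
  have closed: "A + B \<in> gl2" "c \<cdot>\<^sub>m A \<in> gl2" "A * B - B * A \<in> gl2" if "A \<in> gl2" "B \<in> gl2" for A B c
    using that by (auto simp: gl2_def mult_carrier_mat[of _ 2 2 _ 2] minus_carrier_mat)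
  note carrier' = carrier[OF gl2_traceless_sl2]
  show "lie_rep gl2 d \<rho>"
    unfolding lie_rep_def
  proof (intro conjI ballI allI)
    fix A B c assume A: "A \<in> gl2" and B: "B \<in> gl2"
    have scalar_add: "gl2_scalar (A + B) = gl2_scalar A + gl2_scalar B"
      using A B by (simp add: gl2_scalar_def gl2_def mat_trace_add[of _ 2] add_divide_distrib)
    show "\<rho> (A + B) = \<rho> A + \<rho> B"
      using carrier'[OF A] carrier'[OF B]
      by (intro eq_matI) (auto simp: \<rho> A B closed gl2_traceless_add gl2_traceless_sl2 add scalar_add algebra_simps)
    show "\<rho> (A * B - B * A) = \<rho> A * \<rho> B - \<rho> B * \<rho> A"
      using carrier'[OF A] carrier'[OF B]
      by (simp add: \<rho> A B closed gl2_traceless_bracket gl2_traceless_sl2 bracket gl2_scalar_bracket shifted_bracket)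
        (intro eq_matI, auto)
  next
    fix A c assume A: "A \<in> gl2"
    show "\<rho> A \<in> carrier_mat d d"
      using carrier'[OF A] by (simp add: \<rho> A)
    have "gl2_scalar (c \<cdot>\<^sub>m A) = c * gl2_scalar A"
      using A by (simp add: gl2_scalar_def gl2_def mat_trace_smult[of _ 2])
    then show "\<rho> (c \<cdot>\<^sub>m A) = c \<cdot>\<^sub>m \<rho> A"
      using carrier'[OF A]
      by (intro eq_matI) (auto simp: \<rho> A closed[OF A A] gl2_traceless_smult gl2_traceless_sl2 smult algebra_simps)
  qed
qed

text \<open>The form of the sl_2-part still works: the scalar parts of A and of its adjoint are
  complex conjugates and act as such, the twisting parameter 1 being real.\<close>

lemma young_rep_invariant_form:
  assumes "young_rep d \<rho>"
  obtains n S R where "S \<in> carrier_mat d n" "R \<in> carrier_mat d n"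
    "(S * S\<^sup>\<dagger>) * (R * R\<^sup>\<dagger>) = 1\<^sub>m d"
    "\<And>A. A \<in> gl2 \<Longrightarrow> \<rho> A * (S * S\<^sup>\<dagger>) = (S * S\<^sup>\<dagger>) * (\<rho> (A\<^sup>\<dagger>))\<^sup>\<dagger>"
proof -
  obtain m \<sigma> where \<sigma>: "sl2_irrep m d \<sigma>"
    and \<rho>: "\<And>A. A \<in> gl2 \<Longrightarrow> \<rho> A = \<sigma> (gl2_traceless A) + gl2_scalar A \<cdot>\<^sub>m 1\<^sub>m d"
    using young_rep_cases[OF assms] by auto
  obtain S R where SR: "S \<in> carrier_mat d (Suc m)" "R \<in> carrier_mat d (Suc m)"
    "(S * S\<^sup>\<dagger>) * (R * R\<^sup>\<dagger>) = 1\<^sub>m d"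
    and inv: "\<And>A. A \<in> sl2 \<Longrightarrow> \<sigma> A * (S * S\<^sup>\<dagger>) = (S * S\<^sup>\<dagger>) * (\<sigma> (A\<^sup>\<dagger>))\<^sup>\<dagger>"
    using sl2_irrep_invariant_form[OF \<sigma>] by blast
  have carrier: "\<sigma> A \<in> carrier_mat d d" if "A \<in> sl2" for A
    using \<sigma> that by (simp add: sl2_irrep_def irreducible_lie_rep_def lie_rep_def)
  have P: "S * S\<^sup>\<dagger> \<in> carrier_mat d d"
    using mult_carrier_mat[OF SR(1) adjoint_carrier[OF SR(1)]] .
  have "\<rho> A * (S * S\<^sup>\<dagger>) = (S * S\<^sup>\<dagger>) * (\<rho> (A\<^sup>\<dagger>))\<^sup>\<dagger>" if A: "A \<in> gl2" for A
  proof -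
    let ?P = "S * S\<^sup>\<dagger>"
    have A': "A\<^sup>\<dagger> \<in> gl2" and scalar: "gl2_scalar (A\<^sup>\<dagger>) = cnj (gl2_scalar A)"
      using A by (simp_all add: gl2_def gl2_scalar_def mat_trace_adjoint[of _ 2])
    note T = gl2_traceless_sl2[OF A] gl2_traceless_sl2[OF A']
    have "1\<^sub>m d * ?P = ?P * (1\<^sub>m d)\<^sup>\<dagger>"
      by (simp only: adjoint_one left_mult_one_mat[OF P] right_mult_one_mat[OF P])
    then have "(gl2_scalar A \<cdot>\<^sub>m 1\<^sub>m d) * ?P = ?P * (cnj (gl2_scalar A) \<cdot>\<^sub>m 1\<^sub>m d)\<^sup>\<dagger>"
      by (intro mult_adjoint_smult[OF P]) auto
    then show ?thesis
      unfolding \<rho>[OF A] \<rho>[OF A'] scalar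
      using carrier[OF T(1)] carrier[OF T(2)] inv[OF T(1)]
      by (intro mult_adjoint_add[OF P]) (auto simp: gl2_traceless_adjoint[OF A])
  qed
  with SR show ?thesis
    by (rule that)
qed

lemma orthonormal_basis_gl2_carrier:
  "orthonormal_basis_gl2 e \<Longrightarrow> r \<in> {1..4} \<Longrightarrow> e r \<in> gl2"
proof -
  interpret vectorspace class_ring "module_mat TYPE(complex) 2 2"
    by (rule matrix_vs)
  show "orthonormal_basis_gl2 e \<Longrightarrow> r \<in> {1..4} \<Longrightarrow> e r \<in> gl2"
    by (auto simp: orthonormal_basis_gl2_def basis_def gl2_def module_mat_simps)
qed

text \<open>The matrices that satisfy the expansion form a submodule, and by orthonormality it
  contains the basis, hence everything. Coefficients carry no conjugation because the form is
  bilinear.\<close>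

lemma orthonormal_basis_gl2_expansion:
  assumes e: "orthonormal_basis_gl2 e" and A: "A \<in> gl2"
  shows "A = mat_sum 2 (\<lambda>r. mat_trace (A * e r) \<cdot>\<^sub>m e r) {1..4}"
proof -
  interpret V: vectorspace class_ring "module_mat TYPE(complex) 2 2"
    by (rule matrix_vs)
  note e_carrier = orthonormal_basis_gl2_carrier[OF e, unfolded gl2_def]
  let ?ex = "\<lambda>A. mat_sum 2 (\<lambda>r. mat_trace (A * e r) \<cdot>\<^sub>m e r) {1..4}"
  let ?X = "{A \<in> carrier_mat 2 2. A = ?ex A}"
  have "?ex (e s) = e s" if "s \<in> {1..4}" for s
  proof -
    have "mat_sum 2 (\<lambda>r. mat_trace (e s * e r) \<cdot>\<^sub>m e r) {1..4}
        = mat_sum 2 (\<lambda>r. (if s = r then 1 else 0) \<cdot>\<^sub>m e r) {1..4}"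
      using e that by (intro mat_sum_cong) (auto simp: orthonormal_basis_gl2_def)
    also have "\<dots> = e s"
    proof (rule eq_matI)
      fix i j assume "i < dim_row (e s)" "j < dim_col (e s)"
      then have ij: "i < 2" "j < 2"
        using e_carrier[OF that] by auto
      then have "((if s = r then 1 else 0) \<cdot>\<^sub>m e r) $$ (i, j) = (if s = r then e s $$ (i, j) else 0)"
        if "r \<in> {1..4}" for r
        using e_carrier[OF that] by auto
      with ij that show "mat_sum 2 (\<lambda>r. (if s = r then 1 else 0) \<cdot>\<^sub>m e r) {1..4} $$ (i, j) = e s $$ (i, j)"
        by simp
    qed (use e_carrier[OF that] in auto)
    finally show ?thesis .
  qed
  then have "e ` {1..4} \<subseteq> ?X"
    using e_carrier by auto
  moreover have "submodule class_ring ?X (module_mat TYPE(complex) 2 2)"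
  proof (rule submodule.intro, goal_cases)
    case 1
    show ?case ..
  next
    case (3 A B)
    then have A: "A \<in> carrier_mat 2 2" "A = ?ex A" and B: "B \<in> carrier_mat 2 2" "B = ?ex B"
      by auto
    have "?ex (A + B) = mat_sum 2 (\<lambda>r. mat_trace (A * e r) \<cdot>\<^sub>m e r + mat_trace (B * e r) \<cdot>\<^sub>m e r) {1..4}"
    proof (rule mat_sum_cong)
      fix r :: nat assume r: "r \<in> {1..4}"
      show "mat_trace ((A + B) * e r) \<cdot>\<^sub>m e r = mat_trace (A * e r) \<cdot>\<^sub>m e r + mat_trace (B * e r) \<cdot>\<^sub>m e r"
        using A(1) B(1) e_carrier[OF r]
        by (simp add: add_mult_distrib_mat[of A 2 2] mat_trace_add[of _ 2] add_smult_distrib_right_mat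
            mult_carrier_mat[of _ 2 2 _ 2])
    qed simp
    also have "\<dots> = ?ex A + ?ex B"
      using e_carrier by (intro mat_sum_add) auto
    finally show ?case
      using A B by (simp add: module_mat_simps)
  next
    case (5 c A)
    then have A: "A \<in> carrier_mat 2 2" "A = ?ex A"
      by auto
    have "?ex (c \<cdot>\<^sub>m A) = c \<cdot>\<^sub>m ?ex A"
    proof (rule eq_matI, goal_cases)
      case (1 i j)
      have "(mat_trace (c \<cdot>\<^sub>m A * e r) \<cdot>\<^sub>m e r) $$ (i, j) = c * (mat_trace (A * e r) \<cdot>\<^sub>m e r) $$ (i, j)"
        if "r \<in> {1..4}" for r
        using A(1) e_carrier[OF that] 1
        by (simp add: mult_smult_assoc_mat[of A 2 2] mat_trace_smult[of _ 2] mult_carrier_mat[of _ 2 2 _ 2])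
      with 1 show ?case
        by (simp add: sum_distrib_left)
    qed auto
    then show ?case
      using A by (simp add: module_mat_simps)
  next
    case 4
    have "mat_trace (0\<^sub>m 2 2 * e r) \<cdot>\<^sub>m e r = 0\<^sub>m 2 2" if "r \<in> {1..4}" for r
      using e_carrier[OF that]
      by (intro eq_matI) (auto simp: mat_trace_def left_mult_zero_mat[of _ 2 2] simp del: index_mult_mat(1))
    then have "?ex (0\<^sub>m 2 2) = mat_sum 2 (\<lambda>_. 0\<^sub>m 2 2) {1..4::nat}"
      by (intro mat_sum_cong) auto
    also have "\<dots> = 0\<^sub>m 2 2"
      by (intro eq_matI) auto
    finally show ?case
      by (simp add: module_mat_simps)
  qed (auto simp: module_mat_simps)
  ultimately have "V.span (e ` {1..4}) \<subseteq> ?X"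
    by (rule V.span_is_subset)
  moreover have "V.span (e ` {1..4}) = carrier_mat 2 2"
    using e by (simp add: orthonormal_basis_gl2_def V.basis_def module_mat_simps)
  ultimately show ?thesis
    using A by (auto simp: gl2_def)
qed

section \<open>The weight operators\<close>

text \<open>The Leibniz rule [X + Y, x y] = [X, x] y + x [Y, y], valid because X commutes with y and
  Y with x. Here p and q are the two inner commutators.\<close>

lemma bracket_mult_invariant:
  fixes X Y x y p q :: "complex mat"
  assumes carrier: "X \<in> carrier_mat n n" "Y \<in> carrier_mat n n" "x \<in> carrier_mat n n"
      "y \<in> carrier_mat n n" "p \<in> carrier_mat n n" "q \<in> carrier_mat n n"
    and "X * x = x * X + p" "Y * y = y * Y + q" "X * y = y * X" "Y * x = x * Y"
  shows "(X + Y) * (x * y) = (x * y) * (X + Y) + (p * y + x * q)"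
proof -
  interpret matrix_ring n "TYPE(complex)" .
  have "X * (x * y) = (x * X + p) * y"
    using carrier by (simp only: m_assoc[symmetric] assms(7))
  also have "\<dots> = x * (X * y) + p * y"
    using carrier by (simp only: l_distr m_assoc m_closed)
  also have "\<dots> = (x * y) * X + p * y"
    using carrier by (simp only: assms(9) m_assoc)
  finally have 1: "X * (x * y) = (x * y) * X + p * y" .
  have "Y * (x * y) = x * (Y * y)"
    using carrier by (simp only: m_assoc[symmetric] assms(10))
  also have "\<dots> = (x * y) * Y + x * q"
    using carrier by (simp only: assms(8) r_distr m_assoc m_closed)
  finally have 2: "Y * (x * y) = (x * y) * Y + x * q" .
  have "(X + Y) * (x * y) = ((x * y) * X + p * y) + ((x * y) * Y + x * q)"
    using carrier by (simp only: l_distr m_closed 1 2)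
  also have "\<dots> = ((x * y) * X + (x * y) * Y) + (p * y + x * q)"
    using carrier by (simp only: a_ac m_closed a_closed)
  also have "(x * y) * X + (x * y) * Y = (x * y) * (X + Y)"
    using carrier by (simp only: r_distr m_closed)
  finally show ?thesis .
qed

lemma mat_sum_commute:
  assumes "A \<in> carrier_mat n n" "\<And>r. r \<in> I \<Longrightarrow> f r \<in> carrier_mat n n"
    and "\<And>r. r \<in> I \<Longrightarrow> A * f r = f r * A"
  shows "A * mat_sum n f I = mat_sum n f I * A"
proof -
  have "A * mat_sum n f I = mat_sum n (\<lambda>r. A * f r) I"
    using assms(1,2) by (rule mult_mat_sum)
  also have "\<dots> = mat_sum n (\<lambda>r. f r * A) I"
    using assms(3) by (intro mat_sum_cong) auto
  also have "\<dots> = mat_sum n f I * A"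
    using assms(1,2) by (rule mat_sum_mult[symmetric])
  finally show ?thesis .
qed

text \<open>The braid relations ask only for a Lie algebra representation on each strand.
  Irreducibility and positivity come in afterwards, through the matrix \<open>P\<close> of
  \<open>weight_star\<close>.\<close>

locale gl2_strands =
  fixes N :: nat and d :: "nat \<Rightarrow> nat" and \<rho> :: "nat \<Rightarrow> complex mat \<Rightarrow> complex mat"
    and e :: "nat \<Rightarrow> complex mat"
  assumes rep: "k \<in> {1..N} \<Longrightarrow> lie_rep gl2 (d k) (\<rho> k)"
    and orthonormal: "orthonormal_basis_gl2 e"
begin

abbreviation D :: nat where
  "D \<equiv> tensor_dim N d"

lemma D_eq: "D = prod_list (map d [1..<N + 1])"
  using prod.distinct_set_conv_list[of "[1..<N + 1]" d]
  by (simp add: tensor_dim_def atLeastLessThanSuc_atLeastAtMost del: upt_Suc)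

lemma e_gl2: "r \<in> {1..4} \<Longrightarrow> e r \<in> gl2"
  using orthonormal_basis_gl2_carrier[OF orthonormal] .

lemma e_carrier: "r \<in> {1..4} \<Longrightarrow> e r \<in> carrier_mat 2 2"
  using e_gl2 by (simp add: gl2_def)

lemma \<rho>_carrier: "k \<in> {1..N} \<Longrightarrow> A \<in> gl2 \<Longrightarrow> \<rho> k A \<in> carrier_mat (d k) (d k)"
  using rep by (simp add: lie_rep_def)

section \<open>Operators acting on a single tensor factor\<close>

definition strand :: "nat \<Rightarrow> complex mat \<Rightarrow> complex mat" where
  "strand k A = kron_list (map ((\<lambda>l. 1\<^sub>m (d l))(k := \<rho> k A)) [1..<N + 1])"

lemma kron_strands_carrier:
  "(\<And>k. k \<in> {1..N} \<Longrightarrow> f k \<in> carrier_mat (d k) (d k)) \<Longrightarrow>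
    kron_list (map f [1..<N + 1]) \<in> carrier_mat D D"
  unfolding D_eq by (rule kron_list_map_carrier) auto

lemma strand_carrier [simp]:
  "k \<in> {1..N} \<Longrightarrow> A \<in> gl2 \<Longrightarrow> strand k A \<in> carrier_mat D D"
  unfolding strand_def by (rule kron_strands_carrier) (auto intro: \<rho>_carrier)

lemma strand_add:
  assumes "k \<in> {1..N}" "A \<in> gl2" "B \<in> gl2"
  shows "strand k (A + B) = strand k A + strand k B"
proof -
  have "\<rho> k (A + B) = \<rho> k A + \<rho> k B"
    using rep assms by (simp add: lie_rep_def)
  then show ?thesis
    using assms unfolding strand_def
    by (simp only:) (rule kron_list_map_update_add[of _ _ _ d d], auto intro: \<rho>_carrier)
qed

lemma strand_smult:
  assumes "k \<in> {1..N}" "A \<in> gl2"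
  shows "strand k (c \<cdot>\<^sub>m A) = c \<cdot>\<^sub>m strand k A"
proof -
  have "\<rho> k (c \<cdot>\<^sub>m A) = c \<cdot>\<^sub>m \<rho> k A"
    using rep assms by (simp add: lie_rep_def)
  then show ?thesis
    using assms unfolding strand_def
    by (simp only:) (rule kron_list_map_update_smult, auto)
qed

lemma kron_strands_mult:
  assumes "\<And>k. k \<in> {1..N} \<Longrightarrow> f k \<in> carrier_mat (d k) (d k)"
    and "\<And>k. k \<in> {1..N} \<Longrightarrow> g k \<in> carrier_mat (d k) (d k)"
    and "\<And>k. k \<in> {1..N} \<Longrightarrow> f k * g k = h k"
  shows "kron_list (map f [1..<N + 1]) * kron_list (map g [1..<N + 1])
    = kron_list (map h [1..<N + 1])"
proof -
  have "kron_list (map f [1..<N + 1]) * kron_list (map g [1..<N + 1])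
      = kron_list (map (\<lambda>k. f k * g k) [1..<N + 1])"
    using assms(1,2) by (intro kron_list_map_mult[where a = d and b = d and c = d]) auto
  also have "map (\<lambda>k. f k * g k) [1..<N + 1] = map h [1..<N + 1]"
    using assms(3) by (intro map_cong) auto
  finally show ?thesis .
qed

lemma strand_mult_strand:
  assumes "k \<in> {1..N}" "l \<in> {1..N}" "k \<noteq> l" "A \<in> gl2" "B \<in> gl2"
  shows "strand k A * strand l B
    = kron_list (map ((\<lambda>i. 1\<^sub>m (d i))(k := \<rho> k A, l := \<rho> l B)) [1..<N + 1])"
  unfolding strand_def using assms \<rho>_carrier[of k A] \<rho>_carrier[of l B]
  by (intro kron_strands_mult) auto

lemma strand_commute:
  assumes "k \<in> {1..N}" "l \<in> {1..N}" "k \<noteq> l" "A \<in> gl2" "B \<in> gl2"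
  shows "strand k A * strand l B = strand l B * strand k A"
  using assms by (simp add: strand_mult_strand fun_upd_twist)

lemma gl2_bracket_closed: "A \<in> gl2 \<Longrightarrow> B \<in> gl2 \<Longrightarrow> A * B - B * A \<in> gl2"
  by (auto simp: gl2_def mult_carrier_mat[of _ 2 2 _ 2] minus_carrier_mat)

lemma strand_bracket:
  assumes "k \<in> {1..N}" "A \<in> gl2" "B \<in> gl2"
  shows "strand k A * strand k B = strand k B * strand k A + strand k (A * B - B * A)"
proof -
  let ?u = "\<lambda>M. kron_list (map ((\<lambda>l. 1\<^sub>m (d l))(k := M)) [1..<N + 1])"
  note carrier = \<rho>_carrier[OF assms(1,2)] \<rho>_carrier[OF assms(1,3)]
    \<rho>_carrier[OF assms(1) gl2_bracket_closed[OF assms(2,3)]]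
  have mult: "?u M * ?u M' = ?u (M * M')"
    if "M \<in> carrier_mat (d k) (d k)" "M' \<in> carrier_mat (d k) (d k)" for M M'
    using that by (intro kron_strands_mult) auto
  have "\<rho> k (A * B - B * A) = \<rho> k A * \<rho> k B - \<rho> k B * \<rho> k A"
    using rep assms by (simp add: lie_rep_def)
  then have "\<rho> k A * \<rho> k B = \<rho> k B * \<rho> k A + \<rho> k (A * B - B * A)"
    using carrier by (intro eq_matI) (auto simp: mult_carrier_mat[of _ _ "d k"] simp del: index_mult_mat(1))
  then have "strand k A * strand k B = ?u (\<rho> k B * \<rho> k A + \<rho> k (A * B - B * A))"
    unfolding strand_def by (simp only: mult carrier)
  also have "\<dots> = ?u (\<rho> k B * \<rho> k A) + ?u (\<rho> k (A * B - B * A))"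
    using assms carrier
    by (intro kron_list_map_update_add[of _ _ _ d d]) (auto intro: mult_carrier_mat)
  also have "?u (\<rho> k B * \<rho> k A) = strand k B * strand k A"
    unfolding strand_def by (simp only: mult carrier)
  finally show ?thesis
    unfolding strand_def .
qed

lemma strand_mat_sum:
  assumes k: "k \<in> {1..N}" and "finite I" "\<And>r. r \<in> I \<Longrightarrow> f r \<in> gl2"
  shows "strand k (mat_sum 2 (\<lambda>r. c r \<cdot>\<^sub>m f r) I) = mat_sum D (\<lambda>r. c r \<cdot>\<^sub>m strand k (f r)) I"
  using assms(2,3)
proof (induction I rule: finite_induct)
  case empty
  \<comment> \<open>The zero matrix is written as 0 times itself, so that homogeneity shows that it
    acts as zero.\<close>
  have "0\<^sub>m 2 2 \<in> gl2"
    by (simp add: gl2_def)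
  with k have "strand k (0 \<cdot>\<^sub>m 0\<^sub>m 2 2) = 0 \<cdot>\<^sub>m strand k (0\<^sub>m 2 2)" "strand k (0\<^sub>m 2 2) \<in> carrier_mat D D"
    by (simp_all only: strand_smult strand_carrier)
  moreover from this(2) have "0 \<cdot>\<^sub>m strand k (0\<^sub>m 2 2) = 0\<^sub>m D D"
    by (intro eq_matI) auto
  moreover have "0 \<cdot>\<^sub>m 0\<^sub>m 2 2 = (0\<^sub>m 2 2 :: complex mat)"
    by (intro eq_matI) auto
  ultimately show ?case
    by simp
next
  case (insert r I)
  then have "c r \<cdot>\<^sub>m f r \<in> gl2" "mat_sum 2 (\<lambda>r. c r \<cdot>\<^sub>m f r) I \<in> gl2"
    by (auto simp: gl2_def)
  with insert k show ?case
    by (simp add: mat_sum_insert strand_add strand_smult gl2_def)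
qed

lemma strand_expansion:
  assumes "k \<in> {1..N}" "A \<in> gl2"
  shows "strand k A = mat_sum D (\<lambda>s. mat_trace (A * e s) \<cdot>\<^sub>m strand k (e s)) {1..4}"
  using strand_mat_sum[OF assms(1), of "{1..4}" e "\<lambda>s. mat_trace (A * e s)"] e_gl2
    orthonormal_basis_gl2_expansion[OF orthonormal assms(2)] by simp

section \<open>Chord operators and the 2T and 4T relations\<close>

lemma chord_term_carrier:
  assumes "r \<in> {1..4}"
  shows "kron_list (map (\<lambda>k. if k = i \<or> k = j then \<rho> k (e r) else 1\<^sub>m (d k)) [1..<N + 1])
    \<in> carrier_mat D D"
  using \<rho>_carrier[OF _ e_gl2[OF assms]] by (intro kron_strands_carrier) auto

lemma chord_operator_carrier [simp]: "chord_operator N d \<rho> e c \<in> carrier_mat D D"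
proof -
  obtain i j where c: "c = (i, j)"
    by fastforce
  have "chord_operator N d \<rho> e c
      = mat_sum D (\<lambda>r. kron_list (map (\<lambda>k. if k = i \<or> k = j then \<rho> k (e r) else 1\<^sub>m (d k)) [1..<N + 1])) {1..4}"
    unfolding c chord_operator_def Let_def prod.case
    by (rule finsum_eq_mat_sum[OF _ chord_term_carrier]) auto
  then show ?thesis
    by simp
qed

text \<open>Distinct endpoints matter: for i = j the definition would insert \<open>e r\<close> only
  once, not as a product of two factors.\<close>

lemma chord_operator_eq:
  assumes "i \<in> {1..N}" "j \<in> {1..N}" "i \<noteq> j"
  shows "chord_operator N d \<rho> e (i, j) = mat_sum D (\<lambda>r. strand i (e r) * strand j (e r)) {1..4}"
proof -
  have eq: "kron_list (map (\<lambda>k. if k = i \<or> k = j then \<rho> k (e r) else 1\<^sub>m (d k)) [1..<N + 1])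
      = strand i (e r) * strand j (e r)" if "r \<in> {1..4}" for r
    using assms e_gl2[OF that]
    by (subst strand_mult_strand) (auto intro!: arg_cong[of _ _ kron_list])
  have "chord_operator N d \<rho> e (i, j)
      = mat_sum D (\<lambda>r. kron_list (map (\<lambda>k. if k = i \<or> k = j then \<rho> k (e r) else 1\<^sub>m (d k)) [1..<N + 1])) {1..4}"
    unfolding chord_operator_def Let_def prod.case
    by (rule finsum_eq_mat_sum[OF _ chord_term_carrier]) auto
  also have "\<dots> = mat_sum D (\<lambda>r. strand i (e r) * strand j (e r)) {1..4}"
    using eq by (intro mat_sum_cong) auto
  finally show ?thesis .
qed

abbreviation C :: "nat \<Rightarrow> nat \<Rightarrow> complex mat" where
  "C i j \<equiv> chord_operator N d \<rho> e (i, j)"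

lemma C_commute: "C i j = C j i"
  by (simp add: chord_operator_def disj_commute)

lemma strand_mult_carrier:
  "i \<in> {1..N} \<Longrightarrow> j \<in> {1..N} \<Longrightarrow> A \<in> gl2 \<Longrightarrow> B \<in> gl2 \<Longrightarrow> strand i A * strand j B \<in> carrier_mat D D"
  by (rule mult_carrier_mat[OF strand_carrier strand_carrier])

lemma assoc_D:
  "A \<in> carrier_mat D D \<Longrightarrow> B \<in> carrier_mat D D \<Longrightarrow> M \<in> carrier_mat D D \<Longrightarrow> (A * B) * M = A * (B * M)"
  by (rule assoc_mult_mat)

lemma strand_C_commute:
  assumes "i \<in> {1..N}" "j \<in> {1..N}" "i \<noteq> j" "k \<in> {1..N}" "k \<noteq> i" "k \<noteq> j" "A \<in> gl2"
  shows "strand k A * C i j = C i j * strand k A"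
proof -
  have "strand k A * (strand i (e r) * strand j (e r)) = (strand i (e r) * strand j (e r)) * strand k A"
    if "r \<in> {1..4}" for r
  proof -
    note T = strand_carrier[OF assms(4,7)] strand_carrier[OF assms(1) e_gl2[OF that]]
      strand_carrier[OF assms(2) e_gl2[OF that]]
    note commute = strand_commute[OF assms(4,1,5,7) e_gl2[OF that]]
      strand_commute[OF assms(4,2,6,7) e_gl2[OF that]]
    have "strand k A * (strand i (e r) * strand j (e r)) = strand i (e r) * (strand k A * strand j (e r))"
      using T by (simp only: assoc_D[symmetric] commute(1))
    also have "\<dots> = (strand i (e r) * strand j (e r)) * strand k A"
      using T by (simp only: assoc_D commute(2))
    finally show ?thesis .
  qed
  then show ?thesis
    unfolding chord_operator_eq[OF assms(1-3)]
    by (intro mat_sum_commute strand_carrier strand_mult_carrier assms e_gl2)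
qed

lemma two_term:
  assumes "i \<in> {1..N}" "j \<in> {1..N}" "i \<noteq> j" "k \<in> {1..N}" "l \<in> {1..N}" "k \<noteq> l"
    and "i \<noteq> k" "i \<noteq> l" "j \<noteq> k" "j \<noteq> l"
  shows "C i j * C k l = C k l * C i j"
proof -
  have "(strand i (e r) * strand j (e r)) * C k l = C k l * (strand i (e r) * strand j (e r))"
    if "r \<in> {1..4}" for r
  proof -
    note T = strand_carrier[OF assms(1) e_gl2[OF that]] strand_carrier[OF assms(2) e_gl2[OF that]]
      chord_operator_carrier
    have commute: "strand i (e r) * C k l = C k l * strand i (e r)"
      "strand j (e r) * C k l = C k l * strand j (e r)"
      using assms e_gl2[OF that] by (auto intro!: strand_C_commute)
    have "(strand i (e r) * strand j (e r)) * C k l = strand i (e r) * (C k l * strand j (e r))"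
      using T by (simp only: assoc_D commute(2))
    also have "\<dots> = C k l * (strand i (e r) * strand j (e r))"
      using T by (simp only: assoc_D[symmetric] commute(1))
    finally show ?thesis .
  qed
  then show ?thesis
    unfolding chord_operator_eq[OF assms(1-3)]
    by (intro mat_sum_commute[symmetric] chord_operator_carrier strand_mult_carrier assms e_gl2) auto
qed

text \<open>By cyclicity of the trace both sides equal Tr (A X Y) - Tr (A Y X).\<close>

lemma mat_trace_bracket:
  assumes "A \<in> carrier_mat 2 2" "X \<in> carrier_mat 2 2" "Y \<in> carrier_mat 2 2"
  shows "mat_trace ((A * X - X * A) * Y) = - mat_trace ((A * Y - Y * A) * X)"
proof -
  note m = mult_carrier_mat[of _ 2 2 _ 2]
  have "mat_trace ((A * X - X * A) * Y) = mat_trace (A * X * Y) - mat_trace (X * A * Y)"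
    if "X \<in> carrier_mat 2 2" "Y \<in> carrier_mat 2 2" for X Y
    using that assms(1) by (simp add: minus_mult_distrib_mat[of _ 2 2] mat_trace_diff[of _ 2] m del: assoc_mult_mat)
  moreover have "mat_trace (X * A * Y) = mat_trace (A * Y * X)"
    if "X \<in> carrier_mat 2 2" "Y \<in> carrier_mat 2 2" for X Y
  proof -
    have "mat_trace (X * A * Y) = mat_trace (X * (A * Y))"
      using that assms(1) by simp
    also have "\<dots> = mat_trace (A * Y * X)"
      using that assms(1) by (intro mat_trace_mult_commute[of _ 2 2]) (auto intro: m)
    finally show ?thesis .
  qed
  ultimately show ?thesis
    using assms by simp
qed

text \<open>Invariance of the split Casimir element. The Leibniz rule leaves the terms with [A, e r]
  on strand i and with [A, e r] on strand j; expanding these commutators in the basis makes the two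
  families cancel.\<close>

lemma C_invariant:
  assumes i: "i \<in> {1..N}" and j: "j \<in> {1..N}" and "i \<noteq> j" and A: "A \<in> gl2"
  shows "(strand i A + strand j A) * C i j = C i j * (strand i A + strand j A)"
proof -
  let ?U = "strand i A + strand j A" and ?ad = "\<lambda>r. A * e r - e r * A"
  let ?a = "\<lambda>r s. mat_trace (?ad r * e s)" and ?z = "\<lambda>s r. strand i (e s) * strand j (e r)"
  have U: "?U \<in> carrier_mat D D"
    using i j A by simp
  have ad: "?ad r \<in> gl2" if "r \<in> {1..4}" for r
    using A e_gl2[OF that] by (rule gl2_bracket_closed)
  have z: "?z s r \<in> carrier_mat D D" if "s \<in> {1..4}" "r \<in> {1..4}" for r s
    using i j e_gl2 that by (intro strand_mult_carrier) auto
  let ?p = "\<lambda>r. strand i (?ad r) * strand j (e r)" and ?q = "\<lambda>r. strand i (e r) * strand j (?ad r)"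
  have step: "?U * ?z r r = ?z r r * ?U + (?p r + ?q r)" if r: "r \<in> {1..4}" for r
    using \<open>i \<noteq> j\<close> ad[OF r] e_gl2[OF r] i j A
    by (intro bracket_mult_invariant[OF strand_carrier strand_carrier strand_carrier strand_carrier
          strand_carrier strand_carrier strand_bracket strand_bracket strand_commute strand_commute])
      auto
  have p: "?p r = mat_sum D (\<lambda>s. ?a r s \<cdot>\<^sub>m ?z s r) {1..4}" if r: "r \<in> {1..4}" for r
    unfolding strand_expansion[OF i ad[OF r]] using i j e_gl2 r
    by (subst mat_sum_mult) (auto intro!: mat_sum_cong mult_smult_assoc_mat[of _ D D _ D])
  have q: "?q r = mat_sum D (\<lambda>s. ?a r s \<cdot>\<^sub>m ?z r s) {1..4}" if r: "r \<in> {1..4}" for r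
    unfolding strand_expansion[OF j ad[OF r]] using i j e_gl2 r
    by (subst mult_mat_sum) (auto intro!: mat_sum_cong mult_smult_distrib[of _ D D _ D])
  have p_carrier: "?p r \<in> carrier_mat D D" and q_carrier: "?q r \<in> carrier_mat D D" if "r \<in> {1..4}" for r
    using i j ad e_gl2 that by (auto intro!: strand_mult_carrier)
  \<comment> \<open>Exchanging r and s puts this sum over the same products \<open>?z s r\<close> as
    the sum of \<open>?p\<close>, so that coefficients can be compared.\<close>
  have "mat_sum D ?q {1..4} = mat_sum D (\<lambda>r. mat_sum D (\<lambda>s. ?a r s \<cdot>\<^sub>m ?z r s) {1..4}) {1..4}"
    using q by (intro mat_sum_cong) auto
  also have "\<dots> = mat_sum D (\<lambda>r. mat_sum D (\<lambda>s. ?a s r \<cdot>\<^sub>m ?z s r) {1..4}) {1..4}"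
    by (rule mat_sum_swap)
  finally have sum_q: "mat_sum D ?q {1..4} = mat_sum D (\<lambda>r. mat_sum D (\<lambda>s. ?a s r \<cdot>\<^sub>m ?z s r) {1..4}) {1..4}" .
  have sum_p: "mat_sum D ?p {1..4} = mat_sum D (\<lambda>r. mat_sum D (\<lambda>s. ?a r s \<cdot>\<^sub>m ?z s r) {1..4}) {1..4}"
    using p by (intro mat_sum_cong) auto
  (* ad A is skew for the trace form, so its coefficients ?a are antisymmetric. *)
  have cancel: "mat_sum D ?p {1..4} + mat_sum D ?q {1..4} = 0\<^sub>m D D"
  proof (rule eq_matI, goal_cases)
    case (1 m n)
    then have mn: "m < D" "n < D"
      by auto
    have "((- c) \<cdot>\<^sub>m M) $$ (m, n) + (c \<cdot>\<^sub>m M) $$ (m, n) = 0" if "M \<in> carrier_mat D D" for M and c :: complex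
      using that mn by (auto simp: algebra_simps)
    then have "(?a r s \<cdot>\<^sub>m ?z s r) $$ (m, n) + (?a s r \<cdot>\<^sub>m ?z s r) $$ (m, n) = 0"
      if "r \<in> {1..4}" "s \<in> {1..4}" for r s
      using z[OF that(2,1)] mat_trace_bracket[OF A[unfolded gl2_def] e_carrier[OF that(1)] e_carrier[OF that(2)]]
      by (simp only:)
    then show ?case
      unfolding sum_p sum_q using mn by (simp flip: sum.distrib)
  qed auto
  have "?U * C i j = mat_sum D (\<lambda>r. ?U * ?z r r) {1..4}"
    unfolding chord_operator_eq[OF i j \<open>i \<noteq> j\<close>] using z by (intro mult_mat_sum[OF U])
  also have "\<dots> = mat_sum D (\<lambda>r. ?z r r * ?U + (?p r + ?q r)) {1..4}"
    using step by (intro mat_sum_cong) auto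
  also have "\<dots> = mat_sum D (\<lambda>r. ?z r r * ?U) {1..4} + (mat_sum D ?p {1..4} + mat_sum D ?q {1..4})"
    using z p_carrier q_carrier U
    by (subst mat_sum_add, simp_all add: mult_carrier_mat[of _ D D _ D] del: assoc_mult_mat)
      (subst mat_sum_add, simp_all del: assoc_mult_mat)
  also have "\<dots> = mat_sum D (\<lambda>r. ?z r r * ?U) {1..4}"
    unfolding cancel by (rule right_add_zero_mat) simp
  also have "\<dots> = C i j * ?U"
    unfolding chord_operator_eq[OF i j \<open>i \<noteq> j\<close>] using z by (intro mat_sum_mult[symmetric, OF U])
  finally show ?thesis .
qed

text \<open>Distributivity gathers C i k + C j k into products of the joint action of
  \<open>e r\<close> on strands i and j with its action on strand k. The latter commutes with C i j
  because k is neither endpoint.\<close>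

lemma four_term:
  assumes i: "i \<in> {1..N}" and j: "j \<in> {1..N}" and k: "k \<in> {1..N}"
    and "i \<noteq> j" "i \<noteq> k" "j \<noteq> k"
  shows "C i j * C i k + C i j * C j k = C i k * C i j + C j k * C i j"
proof -
  let ?U = "\<lambda>r. strand i (e r) + strand j (e r)"
  have U: "?U r \<in> carrier_mat D D" if "r \<in> {1..4}" for r
    using i j e_gl2[OF that] by simp
  have Uk: "?U r * strand k (e r) \<in> carrier_mat D D" if "r \<in> {1..4}" for r
    using U[OF that] strand_carrier[OF k e_gl2[OF that]] by (rule mult_carrier_mat)
  have "C i k + C j k = mat_sum D (\<lambda>r. strand i (e r) * strand k (e r) + strand j (e r) * strand k (e r)) {1..4}"
    using assms e_gl2 unfolding chord_operator_eq[OF i k \<open>i \<noteq> k\<close>] chord_operator_eq[OF j k \<open>j \<noteq> k\<close>]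
    by (intro mat_sum_add[symmetric] strand_mult_carrier)
  also have "\<dots> = mat_sum D (\<lambda>r. ?U r * strand k (e r)) {1..4}"
    using assms e_gl2 by (intro mat_sum_cong) (auto intro!: add_mult_distrib_mat[of _ D D _ _ D, symmetric])
  finally have sum: "C i k + C j k = mat_sum D (\<lambda>r. ?U r * strand k (e r)) {1..4}" .
  have commute: "C i j * (?U r * strand k (e r)) = (?U r * strand k (e r)) * C i j" if r: "r \<in> {1..4}" for r
  proof -
    note T = U[OF r] strand_carrier[OF k e_gl2[OF r]] chord_operator_carrier
    have "C i j * (?U r * strand k (e r)) = ?U r * (C i j * strand k (e r))"
      using T C_invariant[OF i j \<open>i \<noteq> j\<close> e_gl2[OF r]] by (simp only: assoc_D[symmetric])
    also have "\<dots> = (?U r * strand k (e r)) * C i j"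
      using T strand_C_commute[OF i j \<open>i \<noteq> j\<close> k _ _ e_gl2[OF r]] assms by (simp only: assoc_D)
    finally show ?thesis .
  qed
  have "C i j * C i k + C i j * C j k = C i j * (C i k + C j k)"
    by (rule mult_add_distrib_mat[symmetric]) (rule chord_operator_carrier)+
  also have "\<dots> = (C i k + C j k) * C i j"
    unfolding sum by (rule mat_sum_commute[OF chord_operator_carrier Uk commute])
  also have "\<dots> = C i k * C i j + C j k * C i j"
    by (rule add_mult_distrib_mat) (rule chord_operator_carrier)+
  finally show ?thesis .
qed


section \<open>The weight operator on the free algebra and on cosets\<close>

abbreviation DO :: "diagram \<Rightarrow> complex mat" where
  "DO w \<equiv> diagram_operator N d \<rho> e w"

abbreviation W :: "(diagram \<Rightarrow>\<^sub>0 complex) \<Rightarrow> complex mat" where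
  "W x \<equiv> free_weight_operator N d \<rho> e x"

lemma diagram_operator_Nil: "DO (Diagram []) = 1\<^sub>m D"
  and diagram_operator_Cons: "DO (Diagram (c # cs)) = chord_operator N d \<rho> e c * DO (Diagram cs)"
  by (simp_all add: diagram_operator_def)

lemma diagram_operator_zero: "DO 0 = 1\<^sub>m D"
  by (simp add: zero_diagram_def diagram_operator_Nil)

lemma diagram_operator_carrier [simp]: "DO w \<in> carrier_mat D D"
proof (cases w)
  case (Diagram cs)
  have "DO (Diagram cs) \<in> carrier_mat D D"
    by (induction cs)
      (auto simp: diagram_operator_Nil diagram_operator_Cons intro!: mult_carrier_mat[of _ D D])
  with Diagram show ?thesis
    by simp
qed

lemma diagram_operator_plus: "DO (v + w) = DO v * DO w"
proof (cases v)
  case (Diagram cs)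
  have "DO (Diagram (cs @ chords w)) = DO (Diagram cs) * DO w"
  proof (induction cs)
    case (Cons c cs)
    then show ?case
      by (simp add: diagram_operator_Cons assoc_D del: assoc_mult_mat)
  qed (simp add: diagram_operator_Nil left_mult_one_mat[OF diagram_operator_carrier])
  with Diagram show ?thesis
    by (simp add: plus_diagram_def)
qed

lemma weight_superset:
  assumes "finite A" "Poly_Mapping.keys x \<subseteq> A"
  shows "W x = mat_sum D (\<lambda>w. Poly_Mapping.lookup x w \<cdot>\<^sub>m DO w) A"
proof -
  have dims [simp]: "dim_row (DO w) = D" "dim_col (DO w) = D" for w
    using diagram_operator_carrier[of w] by (auto simp del: diagram_operator_carrier)
  have "W x = mat_sum D (\<lambda>w. Poly_Mapping.lookup x w \<cdot>\<^sub>m DO w) (Poly_Mapping.keys x)"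
    unfolding free_weight_operator_def Let_def by (rule finsum_eq_mat_sum) auto
  also have "\<dots> = mat_sum D (\<lambda>w. Poly_Mapping.lookup x w \<cdot>\<^sub>m DO w) A"
    using assms by (intro eq_matI) (auto simp: in_keys_iff intro!: sum.mono_neutral_left)
  finally show ?thesis .
qed

lemma weight_carrier [simp]: "W x \<in> carrier_mat D D"
  using weight_superset[of "Poly_Mapping.keys x" x] by simp

lemma dim_weight [simp]: "dim_row (W x) = D" "dim_col (W x) = D"
  using weight_carrier[of x] by (auto simp del: weight_carrier)

lemma weight_single: "W (Poly_Mapping.single w c) = c \<cdot>\<^sub>m DO w"
proof -
  have "W (Poly_Mapping.single w c) = mat_sum D (\<lambda>v. Poly_Mapping.lookup (Poly_Mapping.single w c) v \<cdot>\<^sub>m DO v) {w}"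
    by (rule weight_superset) auto
  also have "\<dots> = c \<cdot>\<^sub>m DO w"
    using diagram_operator_carrier[of w] by (intro eq_matI) (auto simp del: diagram_operator_carrier)
  finally show ?thesis .
qed

lemma weight_zero: "W 0 = 0\<^sub>m D D"
  by (subst weight_superset[of "{}"]) auto

lemma weight_add: "W (x + y) = W x + W y"
proof -
  let ?A = "Poly_Mapping.keys x \<union> Poly_Mapping.keys y"
  have "W z = mat_sum D (\<lambda>w. Poly_Mapping.lookup z w \<cdot>\<^sub>m DO w) ?A"
    if "z = x \<or> z = y \<or> z = x + y" for z
    using that Poly_Mapping.keys_add[of x y] by (intro weight_superset) auto
  then show ?thesis
    by (simp add: lookup_add add_smult_distrib_right_mat[OF diagram_operator_carrier] mat_sum_add)
qed

lemma weight_uminus: "W (- x) = - W x"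
proof (rule eq_matI, goal_cases)
  case (1 i j)
  have "(W x + W (- x)) $$ (i, j) = 0"
    using 1 by (simp add: weight_zero flip: weight_add)
  with 1 show ?case
    by (simp add: add_eq_0_iff)
qed auto

lemma weight_diff: "W (x - y) = W x - W y"
  using weight_add[of x "- y"] by (auto simp: weight_uminus intro!: eq_matI)

lemma weight_mult: "W (x * y) = W x * W y"
proof (induction x rule: poly_mapping_induct_add)
  case (single v c)
  show ?case
  proof (induction y rule: poly_mapping_induct_add)
    case (single w c')
    have "(c \<cdot>\<^sub>m DO v) * (c' \<cdot>\<^sub>m DO w) = (c * c') \<cdot>\<^sub>m (DO v * DO w)"
      by (subst mult_smult_assoc_mat[of _ D D _ D], simp, simp, subst mult_smult_distrib[of _ D D _ D])
        (auto intro!: eq_matI)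
    then show ?case
      by (simp add: mult_single weight_single diagram_operator_plus)
  qed (simp_all add: weight_zero weight_add distrib_left
      mult_add_distrib_mat[OF weight_carrier weight_carrier weight_carrier])
qed (simp_all add: weight_zero weight_add distrib_right
    add_mult_distrib_mat[OF weight_carrier weight_carrier weight_carrier])

lemma weight_one: "W 1 = 1\<^sub>m D"
  using weight_single[of 0 1] by (auto simp: diagram_operator_zero intro!: eq_matI)

lemma weight_scale: "W (Poly_Mapping.single 0 c * x) = c \<cdot>\<^sub>m W x"
  by (simp add: weight_mult weight_single diagram_operator_zero mult_smult_assoc_mat[of _ D D _ D]
      left_mult_one_mat[OF weight_carrier])

lemma weight_chord: "W (chord i j) = C i j"
proof -
  have "C (min i j) (max i j) = C i j"
    using C_commute[of i j] by (auto simp: min_def max_def)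
  then show ?thesis
    by (auto simp: chord_def weight_single diagram_operator_Cons diagram_operator_Nil
        right_mult_one_mat[OF chord_operator_carrier] intro!: eq_matI)
qed

lemma weight_braid_relations:
  assumes "x \<in> braid_relations N"
  shows "W x = 0\<^sub>m D D"
  using assms unfolding braid_relations_def
proof (elim UnE CollectE exE conjE, goal_cases)
  case (1 i j k l)
  then have "C i j * C k l = C k l * C i j"
    by (intro two_term) auto
  then show ?case
    by (auto simp: 1 weight_diff weight_mult weight_chord intro!: minus_r_inv_mat mult_carrier_mat[of _ D D])
next
  case (2 i j k)
  then have "C i j * C i k + C i j * C j k = C i k * C i j + C j k * C i j"
    by (intro four_term) auto
  then have "W x = (C i k * C i j + C j k * C i j) - C i k * C i j - C j k * C i j"
    by (simp add: 2 weight_diff weight_add weight_mult weight_chord)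
  moreover have "A - B1 - B2 = 0\<^sub>m D D"
    if "A = B1 + B2" "B1 \<in> carrier_mat D D" "B2 \<in> carrier_mat D D" for A B1 B2 :: "complex mat"
    using that by (intro eq_matI) auto
  ultimately show ?case
    using mult_carrier_mat[OF chord_operator_carrier chord_operator_carrier] by metis
qed

text \<open>The kernel of the homomorphism \<open>W\<close> is an ideal and contains the
  generators.\<close>

lemma weight_braid_ideal:
  assumes "x \<in> braid_ideal N"
  shows "W x = 0\<^sub>m D D"
proof -
  let ?J = "{x \<in> carrier (free_algebra N). W x = 0\<^sub>m D D}"
  have "ideal ?J (free_algebra N)"
    using free.zero_closed[of N, unfolded free_algebra_simps(4)]
    by (intro ideal_free_algebraI)
      (auto simp: free_algebra_closed weight_zero weight_add weight_uminus weight_mult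
        left_mult_zero_mat[OF weight_carrier] right_mult_zero_mat[OF weight_carrier] intro!: eq_matI)
  moreover have "braid_relations N \<subseteq> ?J"
    using braid_relations_closed weight_braid_relations by auto
  ultimately show ?thesis
    using braid_ideal_minimal assms by blast
qed

text \<open>This gives \<open>the_elem\<close> its meaning: \<open>W\<close> is constant on a coset,
  which is not empty, so its image is a singleton.\<close>

lemma weight_operator_coset: "weight_operator N d \<rho> e (coset N x) = W x"
proof -
  have "W ` coset N x = {W x}"
    using zero_in_braid_ideal[of N] weight_carrier[of x]
    by (auto simp: coset_eq image_image weight_add weight_braid_ideal simp del: weight_carrier)
  then show ?thesis
    by (simp add: weight_operator_def)
qed

text \<open>The relation climbs from strands to chords, then to diagrams, where reversal matches the
  reversed order of factors in an adjoint, and to linear combinations, where the conjugated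
  coefficients of \<open>free_star\<close> match those of the adjoint.\<close>

lemma weight_star:
  assumes P: "P \<in> carrier_mat D D"
    and inv: "\<And>k A. k \<in> {1..N} \<Longrightarrow> A \<in> gl2 \<Longrightarrow> strand k A * P = P * (strand k (A\<^sup>\<dagger>))\<^sup>\<dagger>"
    and x: "x \<in> carrier (free_algebra N)"
  shows "W (free_star x) * P = P * (W x)\<^sup>\<dagger>"
proof -
  have chord: "C i j * P = P * (C i j)\<^sup>\<dagger>" if i: "i \<in> {1..N}" and j: "j \<in> {1..N}" and "i \<noteq> j" for i j
  proof -
    let ?x = "\<lambda>r. strand i (e r)" and ?y = "\<lambda>r. strand j (e r)"
    let ?x' = "\<lambda>r. strand i ((e r)\<^sup>\<dagger>)" and ?y' = "\<lambda>r. strand j ((e r)\<^sup>\<dagger>)"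
    let ?c = "\<lambda>r s. mat_trace ((e r)\<^sup>\<dagger> * e s)"
    have e': "(e r)\<^sup>\<dagger> \<in> gl2" if "r \<in> {1..4}" for r
      using e_gl2[OF that] by (simp add: gl2_def)
    have [simp]: "?x r \<in> carrier_mat D D" "?y r \<in> carrier_mat D D"
      "?x' r \<in> carrier_mat D D" "?y' r \<in> carrier_mat D D" if "r \<in> {1..4}" for r
      using i j e_gl2[OF that] e'[OF that] by simp_all
    have y: "?y s = mat_sum D (\<lambda>r. ?c r s \<cdot>\<^sub>m ?y' r) {1..4}" if s: "s \<in> {1..4}" for s
    proof -
      \<comment> \<open>Expanding the adjoint of \<open>e s\<close> in the basis and taking adjoints
        again expresses \<open>e s\<close> through the adjoint basis.\<close>
      have "e s = (mat_sum 2 (\<lambda>r. mat_trace ((e s)\<^sup>\<dagger> * e r) \<cdot>\<^sub>m e r) {1..4})\<^sup>\<dagger>"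
        using orthonormal_basis_gl2_expansion[OF orthonormal e'[OF s]] adjoint_adjoint[of "e s"] by simp
      also have "\<dots> = mat_sum 2 (\<lambda>r. cnj (mat_trace ((e s)\<^sup>\<dagger> * e r)) \<cdot>\<^sub>m (e r)\<^sup>\<dagger>) {1..4}"
        using e_carrier by (subst adjoint_mat_sum) (auto simp: adjoint_smult)
      also have "\<dots> = mat_sum 2 (\<lambda>r. ?c r s \<cdot>\<^sub>m (e r)\<^sup>\<dagger>) {1..4}"
      proof (rule mat_sum_cong)
        fix r :: nat assume r: "r \<in> {1..4}"
        have "cnj (mat_trace ((e s)\<^sup>\<dagger> * e r)) = mat_trace (((e s)\<^sup>\<dagger> * e r)\<^sup>\<dagger>)"
          using e_carrier[OF r] e_carrier[OF s]
          by (intro mat_trace_adjoint[symmetric]) (auto intro!: mult_carrier_mat[of _ 2 2])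
        also have "((e s)\<^sup>\<dagger> * e r)\<^sup>\<dagger> = (e r)\<^sup>\<dagger> * e s"
          using adjoint_mult[OF adjoint_carrier[OF e_carrier[OF s]] e_carrier[OF r]] by simp
        finally show "cnj (mat_trace ((e s)\<^sup>\<dagger> * e r)) \<cdot>\<^sub>m (e r)\<^sup>\<dagger> = ?c r s \<cdot>\<^sub>m (e r)\<^sup>\<dagger>"
          by simp
      qed simp
      finally have "?y s = strand j (mat_sum 2 (\<lambda>r. ?c r s \<cdot>\<^sub>m (e r)\<^sup>\<dagger>) {1..4})"
        by simp
      also have "\<dots> = mat_sum D (\<lambda>r. ?c r s \<cdot>\<^sub>m ?y' r) {1..4}"
        using e' by (intro strand_mat_sum[OF j]) auto
      finally show ?thesis .
    qed
    have x': "?x' r = mat_sum D (\<lambda>s. ?c r s \<cdot>\<^sub>m ?x s) {1..4}" if "r \<in> {1..4}" for r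
      by (rule strand_expansion[OF i e'[OF that]])
    \<comment> \<open>The same numbers \<open>?c r s\<close> express \<open>?x' r\<close> through
      the \<open>?x s\<close> and \<open>?y s\<close> through the \<open>?y' r\<close>. The double
      sum can therefore be collapsed on either side.\<close>
    have "mat_sum D (\<lambda>r. ?x' r * ?y' r) {1..4}
        = mat_sum D (\<lambda>r. mat_sum D (\<lambda>s. ?c r s \<cdot>\<^sub>m (?x s * ?y' r)) {1..4}) {1..4}"
    proof (rule mat_sum_cong)
      fix r :: nat assume r: "r \<in> {1..4}"
      have "?x' r * ?y' r = mat_sum D (\<lambda>s. (?c r s \<cdot>\<^sub>m ?x s) * ?y' r) {1..4}"
        unfolding x'[OF r] by (rule mat_sum_mult) (use r in auto)
      also have "\<dots> = mat_sum D (\<lambda>s. ?c r s \<cdot>\<^sub>m (?x s * ?y' r)) {1..4}"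
        using r by (intro mat_sum_cong mult_smult_assoc_mat[of _ D D _ D]) auto
      finally show "?x' r * ?y' r = mat_sum D (\<lambda>s. ?c r s \<cdot>\<^sub>m (?x s * ?y' r)) {1..4}" .
    qed simp
    also have "\<dots> = mat_sum D (\<lambda>s. mat_sum D (\<lambda>r. ?c r s \<cdot>\<^sub>m (?x s * ?y' r)) {1..4}) {1..4}"
      by (rule mat_sum_swap)
    also have "\<dots> = mat_sum D (\<lambda>s. ?x s * ?y s) {1..4}"
    proof (rule mat_sum_cong)
      fix s :: nat assume s: "s \<in> {1..4}"
      have "?x s * ?y s = mat_sum D (\<lambda>r. ?x s * (?c r s \<cdot>\<^sub>m ?y' r)) {1..4}"
        unfolding y[OF s] by (rule mult_mat_sum) (use s in auto)
      also have "\<dots> = mat_sum D (\<lambda>r. ?c r s \<cdot>\<^sub>m (?x s * ?y' r)) {1..4}"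
        using s by (intro mat_sum_cong mult_smult_distrib[of _ D D _ D]) auto
      finally show "mat_sum D (\<lambda>r. ?c r s \<cdot>\<^sub>m (?x s * ?y' r)) {1..4} = ?x s * ?y s"
        by simp
    qed simp
    finally have self_adjoint: "mat_sum D (\<lambda>r. ?x' r * ?y' r) {1..4} = C i j"
      unfolding chord_operator_eq[OF i j \<open>i \<noteq> j\<close>] .
    have carrier: "?x r * ?y r \<in> carrier_mat D D" "?x' r * ?y' r \<in> carrier_mat D D" if "r \<in> {1..4}" for r
      using that by (auto intro!: mult_carrier_mat[of _ D D])
    have "C i j * P = mat_sum D (\<lambda>r. (?x r * ?y r) * P) {1..4}"
      unfolding chord_operator_eq[OF i j \<open>i \<noteq> j\<close>] by (rule mat_sum_mult[OF P carrier(1)])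
    also have "\<dots> = mat_sum D (\<lambda>r. P * (?x' r * ?y' r)\<^sup>\<dagger>) {1..4}"
    proof (rule mat_sum_cong)
      fix r :: nat assume r: "r \<in> {1..4}"
      note T = strand_carrier[OF i e_gl2[OF r]] strand_carrier[OF j e_gl2[OF r]]
        strand_carrier[OF i e'[OF r]] strand_carrier[OF j e'[OF r]] P
        strand_carrier[OF i e'[OF r], THEN adjoint_carrier] strand_carrier[OF j e'[OF r], THEN adjoint_carrier]
      have "(?x r * ?y r) * P = ?x r * (P * (?y' r)\<^sup>\<dagger>)"
        using T by (simp only: assoc_D inv[OF j e_gl2[OF r]])
      also have "\<dots> = P * ((?x' r)\<^sup>\<dagger> * (?y' r)\<^sup>\<dagger>)"
        using T by (simp only: assoc_D[symmetric] inv[OF i e_gl2[OF r]])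
      \<comment> \<open>An adjoint reverses the factors; operators on different strands commute,
        which restores the order.\<close>
      also have "(?x' r)\<^sup>\<dagger> * (?y' r)\<^sup>\<dagger> = (?x' r * ?y' r)\<^sup>\<dagger>"
        unfolding strand_commute[OF i j \<open>i \<noteq> j\<close> e'[OF r] e'[OF r]]
        by (rule adjoint_mult[symmetric, OF T(4,3)])
      finally show "(?x r * ?y r) * P = P * (?x' r * ?y' r)\<^sup>\<dagger>" .
    qed simp
    also have "\<dots> = P * mat_sum D (\<lambda>r. (?x' r * ?y' r)\<^sup>\<dagger>) {1..4}"
      by (rule mult_mat_sum[symmetric, OF P]) (rule adjoint_carrier[OF carrier(2)])
    also have "mat_sum D (\<lambda>r. (?x' r * ?y' r)\<^sup>\<dagger>) {1..4} = (mat_sum D (\<lambda>r. ?x' r * ?y' r) {1..4})\<^sup>\<dagger>"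
      by (rule adjoint_mat_sum[symmetric]) (rule carrier(2))
    finally show ?thesis
      unfolding self_adjoint .
  qed
  have diagram: "DO (rev_diagram w) * P = P * (DO w)\<^sup>\<dagger>" if "w \<in> diagrams N" for w
  proof -
    have "DO (Diagram (rev cs)) * P = P * (DO (Diagram cs))\<^sup>\<dagger>" if "Diagram cs \<in> diagrams N" for cs
      using that
    proof (induction cs)
      case Nil
      show ?case
        by (simp add: diagram_operator_Nil left_mult_one_mat[OF P] right_mult_one_mat[OF P])
    next
      case (Cons c cs)
      obtain i j where c: "c = (i, j)" "i \<in> {1..N}" "j \<in> {1..N}" "i \<noteq> j"
        using Cons.prems by (cases c) (auto simp: diagrams_def)
      have IH: "DO (Diagram (rev cs)) * P = P * (DO (Diagram cs))\<^sup>\<dagger>"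
        using Cons by (auto simp: diagrams_def)
      note T = diagram_operator_carrier chord_operator_carrier P
        adjoint_carrier[OF diagram_operator_carrier] adjoint_carrier[OF chord_operator_carrier]
      have "Diagram (rev (c # cs)) = Diagram (rev cs) + Diagram [c]"
        by (simp add: plus_diagram_def)
      then have "DO (Diagram (rev (c # cs))) = DO (Diagram (rev cs)) * C i j"
        by (simp add: diagram_operator_plus diagram_operator_Cons diagram_operator_Nil c
            right_mult_one_mat[OF chord_operator_carrier])
      then have "DO (Diagram (rev (c # cs))) * P = DO (Diagram (rev cs)) * (P * (C i j)\<^sup>\<dagger>)"
        using T by (simp only: assoc_D chord[OF c(2-4)])
      also have "\<dots> = P * ((DO (Diagram cs))\<^sup>\<dagger> * (C i j)\<^sup>\<dagger>)"
        using T by (simp only: assoc_D[symmetric] IH)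
      also have "\<dots> = P * (DO (Diagram (c # cs)))\<^sup>\<dagger>"
        by (simp only: diagram_operator_Cons c adjoint_mult[OF chord_operator_carrier diagram_operator_carrier])
      finally show ?case .
    qed
    with that show ?thesis
      by (cases w) (simp add: rev_diagram_def)
  qed
  \<comment> \<open>The support condition is kept through the induction because
    \<open>diagram\<close> needs chords that join two distinct strands in
    \<open>{1..N}\<close>.\<close>
  have "Poly_Mapping.keys x \<subseteq> diagrams N"
    using x by (simp add: free_algebra_simps)
  then show ?thesis
  proof (induction x rule: poly_mapping_induct_on)
    case zero
    have "(0\<^sub>m D D)\<^sup>\<dagger> = (0\<^sub>m D D :: complex mat)"
      by (intro eq_matI) auto
    with P show ?case
      by (simp add: free_star_zero weight_zero)
  next
    case (single w c)
    have "(cnj c \<cdot>\<^sub>m DO (rev_diagram w)) * P = cnj c \<cdot>\<^sub>m (DO (rev_diagram w) * P)"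
      by (rule mult_smult_assoc_mat[OF diagram_operator_carrier P])
    also have "\<dots> = P * (cnj c \<cdot>\<^sub>m (DO w)\<^sup>\<dagger>)"
      unfolding diagram[OF single]
      by (rule mult_smult_distrib[symmetric, OF P adjoint_carrier[OF diagram_operator_carrier]])
    finally show ?case
      by (simp add: free_star_single weight_single adjoint_smult)
  next
    case (add x y)
    then show ?case
      using mult_adjoint_add[OF P weight_carrier weight_carrier _ weight_carrier weight_carrier,
          of "free_star x" x "free_star y" y]
      by (simp add: free_star_add weight_add)
  qed
qed

end

text \<open>\<open>M'\<close> is the adjoint of \<open>M\<close> for the form. The factors
  \<open>S\<close> and \<open>R\<close> split the form and its inverse evenly between the two copies
  of \<open>M\<close>.\<close>

lemma mat_trace_mult_nonneg:
  fixes M M' S R :: "complex mat"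
  assumes M: "M \<in> carrier_mat n n" and M': "M' \<in> carrier_mat n n"
    and S: "S \<in> carrier_mat n k" and R: "R \<in> carrier_mat n k"
    and inverse: "(S * S\<^sup>\<dagger>) * (R * R\<^sup>\<dagger>) = 1\<^sub>m n" and adjoint: "M' * (S * S\<^sup>\<dagger>) = (S * S\<^sup>\<dagger>) * M\<^sup>\<dagger>"
  shows "mat_trace (M * M') \<in> \<real> \<and> Re (mat_trace (M * M')) \<ge> 0"
proof -
  let ?A = "M * S" and ?B = "R\<^sup>\<dagger>"
  note S' = adjoint_carrier[OF S] and R' = adjoint_carrier[OF R] and M_adj = adjoint_carrier[OF M]
  note SS = mult_carrier_mat[OF S S'] and RR = mult_carrier_mat[OF R R']
  have A: "?A \<in> carrier_mat n k"
    using M S by (rule mult_carrier_mat)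
  note A' = adjoint_carrier[OF A]
  have A'R: "?A\<^sup>\<dagger> * R \<in> carrier_mat k k"
    using A' R by (rule mult_carrier_mat)
  \<comment> \<open>Inserting the identity as the form times its inverse solves the relation
    \<open>adjoint\<close> for \<open>M'\<close>.\<close>
  have "M' = M' * ((S * S\<^sup>\<dagger>) * (R * R\<^sup>\<dagger>))"
    unfolding inverse by (rule right_mult_one_mat[symmetric, OF M'])
  also have "\<dots> = (S * S\<^sup>\<dagger>) * M\<^sup>\<dagger> * (R * R\<^sup>\<dagger>)"
    unfolding adjoint[symmetric] by (rule assoc_mult_mat[symmetric, OF M' SS RR])
  also have "(S * S\<^sup>\<dagger>) * M\<^sup>\<dagger> = S * ?A\<^sup>\<dagger>"
    unfolding adjoint_mult[OF M S] by (rule assoc_mult_mat[OF S S' M_adj])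
  also have "S * ?A\<^sup>\<dagger> * (R * R\<^sup>\<dagger>) = S * (?A\<^sup>\<dagger> * (R * R\<^sup>\<dagger>))"
    by (rule assoc_mult_mat[OF S A' RR])
  also have "?A\<^sup>\<dagger> * (R * R\<^sup>\<dagger>) = ?A\<^sup>\<dagger> * R * R\<^sup>\<dagger>"
    by (rule assoc_mult_mat[symmetric, OF A' R R'])
  finally have "M * M' = M * (S * (?A\<^sup>\<dagger> * R * R\<^sup>\<dagger>))"
    by simp
  also have "\<dots> = ?A * (?A\<^sup>\<dagger> * R * R\<^sup>\<dagger>)"
    by (rule assoc_mult_mat[symmetric, OF M S mult_carrier_mat[OF A'R R']])
  also have "\<dots> = (?A * (?A\<^sup>\<dagger> * R)) * R\<^sup>\<dagger>"
    by (rule assoc_mult_mat[symmetric, OF A A'R R'])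
  \<comment> \<open>Cyclicity brings the trailing \<open>R\<^sup>\<dagger>\<close> to the front,
    where it completes a matrix times its own adjoint.\<close>
  finally have "mat_trace (M * M') = mat_trace (R\<^sup>\<dagger> * (?A * (?A\<^sup>\<dagger> * R)))"
    by (simp only: mat_trace_mult_commute[OF mult_carrier_mat[OF A A'R] R'])
  also have "R\<^sup>\<dagger> * (?A * (?A\<^sup>\<dagger> * R)) = (R\<^sup>\<dagger> * ?A) * (?A\<^sup>\<dagger> * R)"
    by (rule assoc_mult_mat[symmetric, OF R' A A'R])
  also have "?A\<^sup>\<dagger> * R = (R\<^sup>\<dagger> * ?A)\<^sup>\<dagger>"
    by (simp add: adjoint_mult[OF R' A])
  finally show ?thesis
    using mat_trace_mult_adjoint_nonneg by simp
qed

theorem corollary2: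
  fixes N :: nat
    and d :: "nat \<Rightarrow> nat"
    and \<rho> :: "nat \<Rightarrow> complex mat \<Rightarrow> complex mat"
    and e :: "nat \<Rightarrow> complex mat"
  assumes "N \<ge> 1"
    and "\<forall>i\<in>{1..N}. young_rep (d i) (\<rho> i)"
    and "orthonormal_basis_gl2 e"
  shows "quantum_state (chord_algebra N) (weight_system N d \<rho> e)"
proof -
  have young: "young_rep (d k) (\<rho> k)" if "k \<in> {1..N}" for k
    using assms(2) that by blast
  interpret gl2_strands N d \<rho> e
    using assms(3) lie_rep_young_rep(1)[OF young] by unfold_locales
  have "\<exists>n S R. S \<in> carrier_mat (d k) n \<and> R \<in> carrier_mat (d k) n \<and>
      (S * S\<^sup>\<dagger>) * (R * R\<^sup>\<dagger>) = 1\<^sub>m (d k) \<and>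
      (\<forall>A\<in>gl2. \<rho> k A * (S * S\<^sup>\<dagger>) = (S * S\<^sup>\<dagger>) * (\<rho> k (A\<^sup>\<dagger>))\<^sup>\<dagger>)" if "k \<in> {1..N}" for k
    by (rule young_rep_invariant_form[OF young[OF that]]) blast
  then obtain n S R where S: "\<And>k. k \<in> {1..N} \<Longrightarrow> S k \<in> carrier_mat (d k) (n k)"
    and R: "\<And>k. k \<in> {1..N} \<Longrightarrow> R k \<in> carrier_mat (d k) (n k)"
    and inverse: "\<And>k. k \<in> {1..N} \<Longrightarrow> (S k * (S k)\<^sup>\<dagger>) * (R k * (R k)\<^sup>\<dagger>) = 1\<^sub>m (d k)"
    and inv: "\<And>k A. k \<in> {1..N} \<Longrightarrow> A \<in> gl2 \<Longrightarrow>
      \<rho> k A * (S k * (S k)\<^sup>\<dagger>) = (S k * (S k)\<^sup>\<dagger>) * (\<rho> k (A\<^sup>\<dagger>))\<^sup>\<dagger>"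
    by metis
  let ?ks = "[1..<N + 1]"
  define K where "K = prod_list (map n ?ks)"
  \<comment> \<open>Factors of the global form and of its inverse are the Kronecker products of the
    factors on the strands.\<close>
  define SS where "SS = kron_list (map S ?ks)"
  define RR where "RR = kron_list (map R ?ks)"
  have SS: "SS \<in> carrier_mat D K"
    unfolding SS_def K_def D_eq using S by (intro kron_list_map_carrier) auto
  have RR: "RR \<in> carrier_mat D K"
    unfolding RR_def K_def D_eq using R by (intro kron_list_map_carrier) auto
  have PP: "SS * SS\<^sup>\<dagger> = kron_list (map (\<lambda>k. S k * (S k)\<^sup>\<dagger>) ?ks)"
    unfolding SS_def adjoint_kron_list_map using S
    by (intro kron_list_map_mult[where a = d and b = n and c = d]) auto
  have QQ: "RR * RR\<^sup>\<dagger> = kron_list (map (\<lambda>k. R k * (R k)\<^sup>\<dagger>) ?ks)"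
    unfolding RR_def adjoint_kron_list_map using R
    by (intro kron_list_map_mult[where a = d and b = n and c = d]) auto
  have P: "S k * (S k)\<^sup>\<dagger> \<in> carrier_mat (d k) (d k)" and Q: "R k * (R k)\<^sup>\<dagger> \<in> carrier_mat (d k) (d k)"
    if "k \<in> {1..N}" for k
    using mult_carrier_mat[OF S[OF that] adjoint_carrier[OF S[OF that]]]
      mult_carrier_mat[OF R[OF that] adjoint_carrier[OF R[OF that]]] by blast+
  have SS_RR: "(SS * SS\<^sup>\<dagger>) * (RR * RR\<^sup>\<dagger>) = 1\<^sub>m D"
    unfolding PP QQ D_eq kron_list_map_one[symmetric]
    using P Q inverse by (intro kron_strands_mult) auto
  have SS_carrier: "SS * SS\<^sup>\<dagger> \<in> carrier_mat D D" and RR_carrier: "RR * RR\<^sup>\<dagger> \<in> carrier_mat D D"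
    using mult_carrier_mat[OF SS adjoint_carrier[OF SS]] mult_carrier_mat[OF RR adjoint_carrier[OF RR]]
    by blast+
  have strand_inv: "strand k A * (SS * SS\<^sup>\<dagger>) = (SS * SS\<^sup>\<dagger>) * (strand k (A\<^sup>\<dagger>))\<^sup>\<dagger>"
    if k: "k \<in> {1..N}" and A: "A \<in> gl2" for k A
  proof -
    let ?P = "\<lambda>l. S l * (S l)\<^sup>\<dagger>" and ?f = "\<lambda>B l. ((\<lambda>l. 1\<^sub>m (d l))(k := \<rho> k B)) l"
    have A': "A\<^sup>\<dagger> \<in> gl2"
      using A by (simp add: gl2_def)
    have f: "?f B l \<in> carrier_mat (d l) (d l)" if "B \<in> gl2" "l \<in> {1..N}" for B l
      using \<rho>_carrier that k by auto
    \<comment> \<open>Only strand k uses the invariance of its form; on the others \<open>?f\<close>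
      is the identity matrix and the relation is trivial.\<close>
    have eq: "?f A l * ?P l = ?P l * (?f (A\<^sup>\<dagger>) l)\<^sup>\<dagger>" if l: "l \<in> {1..N}" for l
      using inv[OF k A] left_mult_one_mat[OF P[OF l]] right_mult_one_mat[OF P[OF l]]
      by (cases "l = k") (simp_all del: assoc_mult_mat)
    have "strand k A * (SS * SS\<^sup>\<dagger>) = kron_list (map (\<lambda>l. ?P l * (?f (A\<^sup>\<dagger>) l)\<^sup>\<dagger>) ?ks)"
      unfolding strand_def PP by (rule kron_strands_mult[OF f[OF A] P eq])
    also have "\<dots> = (SS * SS\<^sup>\<dagger>) * (strand k (A\<^sup>\<dagger>))\<^sup>\<dagger>"
      unfolding strand_def PP adjoint_kron_list_map
      by (rule kron_strands_mult[symmetric, OF P adjoint_carrier[OF f[OF A']] refl])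
    finally show ?thesis .
  qed
  interpret complex_star_algebra "chord_algebra N"
    by (rule complex_star_algebra_chord_algebra)
  have weight: "weight_system N d \<rho> e (coset N x) = mat_trace (W x)" for x
    by (simp add: weight_system_def weight_operator_coset)
  show ?thesis
  proof
    fix X Y assume "X \<in> carrier (chord_algebra N)" "Y \<in> carrier (chord_algebra N)"
    then show "weight_system N d \<rho> e (X \<oplus>\<^bsub>chord_algebra N\<^esub> Y)
        = weight_system N d \<rho> e X + weight_system N d \<rho> e Y"
      by (auto simp: chord_algebra_simps weight weight_add mat_trace_add[OF weight_carrier weight_carrier])
  next
    fix X c assume "X \<in> carrier (chord_algebra N)"
    then show "weight_system N d \<rho> e (c \<odot>\<^bsub>chord_algebra N\<^esub> X) = c * weight_system N d \<rho> e X"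
      by (auto simp: chord_algebra_simps weight weight_scale mat_trace_smult[OF weight_carrier])
  next
    fix X assume "X \<in> carrier (chord_algebra N)"
    then obtain x where x: "X = coset N x" "x \<in> carrier (free_algebra N)"
      by (auto simp: carrier_chord_algebra)
    have "weight_system N d \<rho> e (X \<otimes>\<^bsub>chord_algebra N\<^esub> \<star>\<^bsub>chord_algebra N\<^esub> X)
        = mat_trace (W x * W (free_star x))"
      using x by (simp add: chord_algebra_simps free_algebra_closed weight weight_mult)
    then show "weight_system N d \<rho> e (X \<otimes>\<^bsub>chord_algebra N\<^esub> \<star>\<^bsub>chord_algebra N\<^esub> X) \<in> \<real> \<and>
        0 \<le> Re (weight_system N d \<rho> e (X \<otimes>\<^bsub>chord_algebra N\<^esub> \<star>\<^bsub>chord_algebra N\<^esub> X))"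
      using mat_trace_mult_nonneg[OF weight_carrier weight_carrier SS RR SS_RR
          weight_star[OF SS_carrier strand_inv x(2)]] by simp
  next
    \<comment> \<open>The weight of the unit is the trace of an identity matrix, hence the dimension
      of the tensor product, and every strand carries a non-zero space.\<close>
    have "D > 0"
      using lie_rep_young_rep(2)[OF young] by (auto simp: tensor_dim_def intro!: prod_pos)
    then show "weight_system N d \<rho> e \<one>\<^bsub>chord_algebra N\<^esub> \<in> \<real> \<and>
        0 < Re (weight_system N d \<rho> e \<one>\<^bsub>chord_algebra N\<^esub>)"
      by (simp add: chord_algebra_simps weight weight_one mat_trace_def)
  qed
qed

end
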